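(* Let $\lambda>0$, let $\mu$ be a probability distribution on $(0,+\infty)$, and let $\rho$ be a random variable with distribution $\mu$. Let $\mathcal{P}$ be a Poisson point process on $\mathbb{R}\times(0,+\infty)$ with intensity measure $\lambda\,du\times\mu$, and let $$\mathcal{U}_+=\bigcup_{(u,\rho_u)\in\mathcal{P}:\,u\ge 0}[u,u+\rho_u]\subset\mathbb{R}_+=[0,\infty)$$ be the occupied set of totally asymmetric Boolean percolation on $\mathbb{R}_+$. Write $a\wedge b=\min(a,b)$. Then: (i) If $\mathbb{E}\rho<\infty$, then almost surely $\mathcal{U}_+$ has no unbounded connected component, and the covered volume fraction of $\mathcal{U}_+$ is almost surely equal to $1-e^{-\lambda\mathbb{E}\rho}$. (ii) If $\int_0^\infty e^{-\lambda\mathbb{E}(\rho\wedge t)}\,dt<\infty$, then almost surely $\mathcal{U}_+$ has an unbounded connected component. (iii) If $\mathbb{E}\rho=\infty$ and $\int_0^\infty e^{-\lambda\mathbb{E}(\rho\wedge t)}\,dt=\infty$, then almost surely $\mathcal{U}_+$ has no unbounded connected component; however, the expected size of the occupied component containing the point $1$ is infinite, and the covered volume fraction of $\mathcal{U}_+$ is almost surely equal to $1$.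
   Context: An occupied component is a connected component of the occupied set $\mathcal{U}_+$. The size of an occupied component is its length, i.e. its one-dimensional Lebesgue measure $\ell$; the occupied component containing $1$ is the connected component of $\mathcal{U}_+$ containing the point $1$, understood as the empty set (of size $0$) if $1\notin\mathcal{U}_+$. The covered volume fraction of $\mathcal{U}_+$ on $\mathbb{R}_+$ is the limit $$\lim_{n\to\infty}\frac{\ell([-n,n]\cap\mathbb{R}_+\cap\mathcal{U}_+)}{\ell([-n,n]\cap\mathbb{R}_+)}=\lim_{n\to\infty}\frac{\ell([0,n]\cap\mathcal{U}_+)}{n};$$ a statement about its value includes the existence of the limit. *)

theory Defs
  imports "HOL-Probability.Probability"
begin

definition num_points :: "'a set \<Rightarrow> 'a set \<Rightarrow> ennreal" where
  "num_points P A = emeasure (count_space UNIV) (P \<inter> A)"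

(* Poisson process with intensity measure S as a random countable subset of the state space,
   over a probability space M. The weight exp (-r) * r ^ k / fact k is spelled out because the
   library's poisson_pmf is only specified for r > 0, whereas r = 0 (with 0 ^ 0 = 1) is needed
   here. A Poisson variable with infinite mean is infinite almost surely. *)
definition poisson_point_process :: "'w measure \<Rightarrow> 'a measure \<Rightarrow> ('w \<Rightarrow> 'a set) \<Rightarrow> bool" where
  "poisson_point_process M S P \<longleftrightarrow>
     (\<forall>\<omega>\<in>space M. countable (P \<omega>) \<and> P \<omega> \<subseteq> space S) \<and>
     (\<forall>A\<in>sets S. (\<lambda>\<omega>. num_points (P \<omega>) A) \<in> borel_measurable M) \<and>
     (\<forall>A\<in>sets S. emeasure S A < \<infinity> \<longrightarrow>
        (\<forall>k::nat. measure M {\<omega> \<in> space M. num_points (P \<omega>) A = of_nat k} =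
           exp (- measure S A) * measure S A ^ k / fact k)) \<and>
     (\<forall>A\<in>sets S. emeasure S A = \<infinity> \<longrightarrow> (AE \<omega> in M. num_points (P \<omega>) A = \<infinity>)) \<and>
     (\<forall>\<A>. finite \<A> \<and> \<A> \<subseteq> sets S \<and> disjoint \<A> \<longrightarrow>
        prob_space.indep_vars M (\<lambda>_. borel) (\<lambda>A \<omega>. num_points (P \<omega>) A) \<A>)"

definition occupied_set :: "(real \<times> real) set \<Rightarrow> real set" where
  "occupied_set P = (\<Union>(u, r) \<in> {(u, r). (u, r) \<in> P \<and> u \<ge> 0}. {u..u + r})"

definition has_unbounded_component :: "real set \<Rightarrow> bool" where
  "has_unbounded_component U \<longleftrightarrow> (\<exists>C\<in>components U. \<not> bounded C)"

(* connected_component_set U x is empty when x is not in U. *)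
definition component_size :: "real set \<Rightarrow> real \<Rightarrow> ennreal" where
  "component_size U x = emeasure lborel (connected_component_set U x)"

(* A predicate rather than a function, so that it includes the existence of the limit. *)
definition has_covered_fraction :: "real set \<Rightarrow> real \<Rightarrow> bool" where
  "has_covered_fraction U v \<longleftrightarrow>
     (\<lambda>n::nat. measure lborel ({- real n..real n} \<inter> {0..} \<inter> U) /
               measure lborel ({- real n..real n} \<inter> {0..})) \<longlonglongrightarrow> v"

end

(* Whether x is vacant is a void event of the Poisson process, of probability exp (- lam E (rho min x)).
   An interval that starts before a vacant point does not reach beyond it, so the vacant integers form
   a renewal process: they occur infinitely often when their probabilities have a divergent sum, and
   otherwise Borel-Cantelli shows that every interval [n, n + 1] with n large is covered. For infinite
   mean radius, a single long interval starting in [0, 1] already gives the component of 1 infinite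
   expected size. The covered fraction is obtained in the style of Etemadi's law of large numbers: along
   the times a^k, radii above a^k are discarded, the second moment of the vacant length is bounded
   with the renewal property, and monotonicity together with a -> 1 fills the gaps. An infinite mean
   radius is treated by truncating the radii at a constant. *)

theory Submission
  imports Defs
begin

subsection \<open>Regenerative events\<close>

text \<open>Vacancies at different integers are dependent, because one long interval covers many of
  them, so a renewal argument takes the place of the second Borel-Cantelli lemma. The probabilities
  involved are void probabilities: products come from additivity of the intensity over disjoint
  sets, shifts from its translation invariance in the starting point. For the covered fraction the
  obstacle is that only the first moment of the radius is at hand. Truncating at level
  \<open>a ^ k\<close> at time \<open>a ^ k\<close> balances two errors: a longer radius starts
  before that time with probability at most lam a^k P(rho > a^k), and Chebyshev's inequality for the
  truncated model costs a multiple of E(rho^2; rho <= a^k) / a^k. For a fixed radius both are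
  geometric sums in k, at most a constant times the radius, so both series are controlled by E rho.
  Open intervals make coverage an open condition, which gives joint measurability in the point and
  the outcome.\<close>

text \<open>If regeneration holds for all finite intersections of the events, then inclusion-exclusion
  extends it to intersections involving complements.\<close>

lemma (in prob_space) regenerative_events_compl:
  fixes E :: "nat \<Rightarrow> 'a set"
  assumes E[measurable]: "\<And>n. E n \<in> events"
    and regen: "\<And>m J. finite J \<Longrightarrow>
      prob {\<omega> \<in> space M. \<omega> \<in> E m \<and> (\<forall>k\<in>J. \<omega> \<in> E (m + k))} =
      prob (E m) * prob {\<omega> \<in> space M. \<forall>k\<in>J. \<omega> \<in> E k}"
    and "finite B" "finite A"
  shows "prob {\<omega> \<in> space M. \<omega> \<in> E m \<and> (\<forall>k\<in>A. \<omega> \<in> E (m + k)) \<and> (\<forall>k\<in>B. \<omega> \<notin> E (m + k))} =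
    prob (E m) * prob {\<omega> \<in> space M. (\<forall>k\<in>A. \<omega> \<in> E k) \<and> (\<forall>k\<in>B. \<omega> \<notin> E k)}"
  using \<open>finite B\<close> \<open>finite A\<close>
proof (induction B arbitrary: A rule: finite_induct)
  case empty
  then show ?case using regen[of A m] by simp
next
  case (insert b B)
  let ?Q = "\<lambda>A B. {\<omega> \<in> space M. \<omega> \<in> E m \<and> (\<forall>k\<in>A. \<omega> \<in> E (m + k)) \<and> (\<forall>k\<in>B. \<omega> \<notin> E (m + k))}"
  let ?R = "\<lambda>A B. {\<omega> \<in> space M. (\<forall>k\<in>A. \<omega> \<in> E k) \<and> (\<forall>k\<in>B. \<omega> \<notin> E k)}"
  have Q: "?Q A B \<in> events" and R: "?R A B \<in> events" for A B
    by measurable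
  have "?Q A (insert b B) = ?Q A B - ?Q (insert b A) B" by auto
  moreover have "prob (?Q A B - ?Q (insert b A) B) = prob (?Q A B) - prob (?Q (insert b A) B)"
    by (intro finite_measure_Diff Q) auto
  ultimately have 1: "prob (?Q A (insert b B)) = prob (?Q A B) - prob (?Q (insert b A) B)" by (simp only:)
  have "?R A (insert b B) = ?R A B - ?R (insert b A) B" by auto
  moreover have "prob (?R A B - ?R (insert b A) B) = prob (?R A B) - prob (?R (insert b A) B)"
    by (intro finite_measure_Diff R) auto
  ultimately have 2: "prob (?R A (insert b B)) = prob (?R A B) - prob (?R (insert b A) B)" by (simp only:)
  have 3: "prob (?Q A B) = prob (E m) * prob (?R A B)"
    using insert.prems by (rule insert.IH)
  have 4: "prob (?Q (insert b A) B) = prob (E m) * prob (?R (insert b A) B)"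
    using insert.prems by (intro insert.IH) auto
  show ?case unfolding 1 2 3 4 by (simp add: algebra_simps)
qed

text \<open>A last occurrence up to \<open>N\<close> at time \<open>m\<close> has probability
  \<open>prob (E m) * q (N - m)\<close>, which is at least \<open>prob (E m) * q N\<close>. These
  events are disjoint for different \<open>m\<close>, so divergence of the sum forces
  \<open>q N\<close> to tend to 0, and almost surely no occurrence is the last one.\<close>

lemma (in prob_space) regenerative_events_infinitely_often:
  fixes E :: "nat \<Rightarrow> 'a set"
  assumes E[measurable]: "\<And>n. E n \<in> events"
    and regen: "\<And>m J. finite J \<Longrightarrow>
      prob {\<omega> \<in> space M. \<omega> \<in> E m \<and> (\<forall>k\<in>J. \<omega> \<in> E (m + k))} =
      prob (E m) * prob {\<omega> \<in> space M. \<forall>k\<in>J. \<omega> \<in> E k}"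
    and div: "\<not> summable (\<lambda>n. prob (E n))"
  shows "AE \<omega> in M. \<exists>\<^sub>\<infinity>n. \<omega> \<in> E n"
proof -
  \<comment> \<open>The range starts at 1 because time 0 stands for the renewal: after an occurrence
    at \<open>m\<close>, the next \<open>N\<close> times stay empty with conditional probability
    \<open>q N\<close>.\<close>
  define q where "q N = prob {\<omega> \<in> space M. \<forall>k\<in>{1..N}. \<omega> \<notin> E k}" for N :: nat
  have last: "prob {\<omega> \<in> space M. \<omega> \<in> E m \<and> (\<forall>k\<in>{1..j}. \<omega> \<notin> E (m + k))} = prob (E m) * q j" for m j
    using regenerative_events_compl[OF E regen, of "{1..j}" "{}" m] by (simp add: q_def)
  have q_anti: "q N \<le> q j" if "j \<le> N" for j N
    unfolding q_def using that by (intro finite_measure_mono) auto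
  have q_nonneg: "q N \<ge> 0" for N by (simp add: q_def)
  \<comment> \<open>decomposition according to the last event that occurs up to time N\<close>
  have bound: "q N * (\<Sum>m\<le>N. prob (E m)) \<le> 1" for N
  proof -
    let ?L = "\<lambda>m. {\<omega> \<in> space M. \<omega> \<in> E m \<and> (\<forall>k\<in>{1..N - m}. \<omega> \<notin> E (m + k))}"
    have disj: "disjoint_family_on ?L {..N}"
    proof (unfold disjoint_family_on_def, intro ballI impI)
      have "False" if "m < n" "n \<le> N" "\<omega> \<in> ?L m" "\<omega> \<in> ?L n" for m n \<omega>
      proof -
        have "n - m \<in> {1..N - m}" using that by auto
        then have "\<omega> \<notin> E (m + (n - m))" using that by blast
        then show False using that by auto
      qed
      then show "\<And>m n. m \<in> {..N} \<Longrightarrow> n \<in> {..N} \<Longrightarrow> m \<noteq> n \<Longrightarrow> ?L m \<inter> ?L n = {}"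
        by (metis (no_types, lifting) atMost_iff disjoint_iff linorder_neqE_nat)
    qed
    have "q N * (\<Sum>m\<le>N. prob (E m)) \<le> (\<Sum>m\<le>N. prob (E m) * q (N - m))"
      unfolding sum_distrib_left
      by (intro sum_mono) (simp add: mult.commute[of "q N"] mult_left_mono q_anti)
    also have "\<dots> = (\<Sum>m\<le>N. prob (?L m))" by (simp only: last)
    also have "\<dots> = prob (\<Union>m\<in>{..N}. ?L m)"
      by (intro finite_measure_finite_Union[symmetric] disj) auto
    also have "\<dots> \<le> 1" by simp
    finally show ?thesis .
  qed
  have q_lim: "q \<longlonglongrightarrow> 0"
  proof -
    have top: "filterlim (\<lambda>N. \<Sum>m\<le>N. prob (E m)) at_top sequentially"
    proof -
      have "filterlim (\<lambda>N. \<Sum>m<N. prob (E m)) at_top sequentially"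
        unfolding filterlim_at_top
      proof (intro allI)
        fix Z
        have "\<exists>n. (\<Sum>m<n. prob (E m)) > Z"
          using summableI_nonneg_bounded[of "\<lambda>n. prob (E n)" Z] div by (force simp: not_less)
        then obtain n where n: "(\<Sum>m<n. prob (E m)) > Z" by blast
        show "\<forall>\<^sub>F N in sequentially. Z \<le> (\<Sum>m<N. prob (E m))"
        proof (rule eventually_sequentiallyI)
          fix N assume "n \<le> N"
          then have "(\<Sum>m<n. prob (E m)) \<le> (\<Sum>m<N. prob (E m))" by (intro sum_mono2) auto
          then show "Z \<le> (\<Sum>m<N. prob (E m))" using n by linarith
        qed
      qed
      then show ?thesis
        unfolding lessThan_Suc_atMost[symmetric] by (subst filterlim_sequentially_Suc)
    qed
    have "(\<lambda>N. 1 / (\<Sum>m\<le>N. prob (E m))) \<longlonglongrightarrow> 0"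
      using tendsto_divide_0[OF tendsto_const, of _ sequentially 1] filterlim_at_top_imp_at_infinity[OF top]
      by blast
    moreover have "\<forall>\<^sub>F N in sequentially. q N \<le> 1 / (\<Sum>m\<le>N. prob (E m))"
      using filterlim_at_top_dense[THEN iffD1, OF top, rule_format, of 0]
      by eventually_elim (use bound in \<open>simp add: field_simps\<close>)
    ultimately show ?thesis
      by (intro tendsto_sandwich[of "\<lambda>_. 0" q sequentially]) (auto simp: q_nonneg)
  qed
  have null: "prob A = 0" if "\<And>N. prob A \<le> q N" for A
    using tendsto_lowerbound[OF q_lim, of "prob A"] that by (auto intro: antisym)
  have after: "AE \<omega> in M. \<not> (\<omega> \<in> E m \<and> (\<forall>k\<ge>1. \<omega> \<notin> E (m + k)))" for m
  proof -
    have "prob {\<omega> \<in> space M. \<omega> \<in> E m \<and> (\<forall>k\<ge>1. \<omega> \<notin> E (m + k))} \<le> q N" for N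
    proof -
      have "prob {\<omega> \<in> space M. \<omega> \<in> E m \<and> (\<forall>k\<ge>1. \<omega> \<notin> E (m + k))} \<le>
        prob {\<omega> \<in> space M. \<omega> \<in> E m \<and> (\<forall>k\<in>{1..N}. \<omega> \<notin> E (m + k))}"
        by (intro finite_measure_mono) auto
      also have "\<dots> \<le> 1 * q N" unfolding last by (intro mult_right_mono q_nonneg) auto
      finally show ?thesis by simp
    qed
    then show ?thesis
      by (subst prob_Collect_eq_0[symmetric]) (auto intro: null)
  qed
  \<comment> \<open>\<open>after\<close> excludes a last occurrence; it remains to exclude that
    there is no occurrence at all.\<close>
  have first: "AE \<omega> in M. \<not> (\<forall>k\<ge>1. \<omega> \<notin> E k)"
  proof -
    have "prob {\<omega> \<in> space M. \<forall>k\<ge>1. \<omega> \<notin> E k} \<le> q N" for N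
      unfolding q_def by (intro finite_measure_mono) auto
    then show ?thesis
      by (subst prob_Collect_eq_0[symmetric]) (auto intro: null)
  qed
  have "AE \<omega> in M. \<forall>m. \<not> (\<omega> \<in> E m \<and> (\<forall>k\<ge>1. \<omega> \<notin> E (m + k)))"
    using after by (simp add: AE_all_countable)
  with first show ?thesis
  proof eventually_elim
    case (elim \<omega>)
    show ?case
    proof (rule ccontr)
      assume "\<not> (\<exists>\<^sub>\<infinity>n. \<omega> \<in> E n)"
      then have fin: "finite {n. \<omega> \<in> E n}" by (simp add: INFM_iff_infinite)
      obtain k where "\<omega> \<in> E k" using elim(1) by blast
      then have "Max {n. \<omega> \<in> E n} \<in> {n. \<omega> \<in> E n}" using fin by (intro Max_in) auto
      then obtain j where "j \<ge> 1" "\<omega> \<in> E (Max {n. \<omega> \<in> E n} + j)" using elim(2) by blast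
      then have "Max {n. \<omega> \<in> E n} + j \<le> Max {n. \<omega> \<in> E n}" using fin by (intro Max_ge) auto
      then show False using \<open>j \<ge> 1\<close> by simp
    qed
  qed
qed

subsection \<open>Estimates for real sequences and components\<close>

text \<open>The integral test. It passes from the integral conditions of the theorem to series over
  the integers: the second bound transfers divergence of the integral, the first its
  convergence.\<close>

lemma antimono_integral_bounds:
  fixes f :: "real \<Rightarrow> real"
  assumes anti: "\<And>x y. 0 \<le> x \<Longrightarrow> x \<le> y \<Longrightarrow> f y \<le> f x"
  shows "(\<Sum>n. ennreal (f (real (Suc n)))) \<le> (\<integral>\<^sup>+x\<in>{0<..}. ennreal (f x) \<partial>lborel)"
    and "(\<integral>\<^sup>+x\<in>{0<..}. ennreal (f x) \<partial>lborel) \<le> (\<Sum>n. ennreal (f (real n)))"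
proof -
  \<comment> \<open>Monotonicity of \<open>f\<close> is known on the half-line only; clamping the
    argument gives a function that is monotone on the whole line and therefore Borel.\<close>
  define g where "g x = f (max 0 x)" for x
  have "(\<lambda>x. - g x) \<in> borel_measurable borel"
    by (intro borel_measurable_mono monoI) (auto simp: g_def intro!: anti)
  then have [measurable]: "g \<in> borel_measurable borel"
    by simp
  define I where "I n = {real n<..real (Suc n)}" for n
  have disj: "disjoint_family I"
    unfolding disjoint_family_on_def I_def by (auto simp flip: not_le)
  have "(\<Union>n. I n) = {0<..}"
  proof (intro set_eqI iffI)
    fix x :: real assume "x \<in> {0<..}"
    then have "x \<in> I (nat \<lceil>x\<rceil> - 1)"
      unfolding I_def by (auto; linarith)
    then show "x \<in> (\<Union>n. I n)" by blast
  qed (auto simp: I_def)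
  then have "(\<integral>\<^sup>+x\<in>{0<..}. ennreal (f x) \<partial>lborel) = (\<integral>\<^sup>+x\<in>(\<Union>n. I n). ennreal (g x) \<partial>lborel)"
    by (intro nn_integral_cong) (auto simp: g_def indicator_def)
  also have "\<dots> = (\<Sum>n. \<integral>\<^sup>+x\<in>I n. ennreal (g x) \<partial>lborel)"
    by (intro nn_integral_disjoint_family disj) (auto simp: I_def)
  finally have eq: "(\<integral>\<^sup>+x\<in>{0<..}. ennreal (f x) \<partial>lborel) = (\<Sum>n. \<integral>\<^sup>+x\<in>I n. ennreal (g x) \<partial>lborel)" .
  have const: "(\<integral>\<^sup>+x. ennreal c * indicator (I n) x \<partial>lborel) = ennreal c" for c n
    by (subst nn_integral_cmult_indicator) (auto simp: I_def)
  have ind: "(\<integral>\<^sup>+x\<in>I n. u x \<partial>lborel) \<le> (\<integral>\<^sup>+x\<in>I n. v x \<partial>lborel)"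
    if "\<And>x. x \<in> I n \<Longrightarrow> u x \<le> v x" for u v :: "real \<Rightarrow> ennreal" and n
    using that by (intro nn_integral_mono) (simp split: split_indicator)
  have "(\<integral>\<^sup>+x\<in>I n. ennreal (f (real (Suc n))) \<partial>lborel) \<le> (\<integral>\<^sup>+x\<in>I n. ennreal (g x) \<partial>lborel)" for n
  proof (intro ind)
    fix x assume "x \<in> I n"
    then show "ennreal (f (real (Suc n))) \<le> ennreal (g x)"
      using anti[of x "real (Suc n)"] by (simp add: I_def g_def ennreal_leI)
  qed
  then show "(\<Sum>n. ennreal (f (real (Suc n)))) \<le> (\<integral>\<^sup>+x\<in>{0<..}. ennreal (f x) \<partial>lborel)"
    unfolding eq const by (intro suminf_le) auto
  have "(\<integral>\<^sup>+x\<in>I n. ennreal (g x) \<partial>lborel) \<le> (\<integral>\<^sup>+x\<in>I n. ennreal (f (real n)) \<partial>lborel)" for n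
  proof (intro ind)
    fix x assume "x \<in> I n"
    then show "ennreal (g x) \<le> ennreal (f (real n))"
      using anti[of "real n" x] by (simp add: I_def g_def ennreal_leI)
  qed
  then show "(\<integral>\<^sup>+x\<in>{0<..}. ennreal (f x) \<partial>lborel) \<le> (\<Sum>n. ennreal (f (real n)))"
    unfolding eq const by (intro suminf_le) auto
qed

text \<open>As \<open>U\<close> is bounded below, an unbounded component extends arbitrarily far to
  the right, and being an interval it would pass over a missing integer beyond any of its
  points.\<close>

lemma not_has_unbounded_component:
  assumes "U \<subseteq> {0..}" and "\<exists>\<^sub>\<infinity>n. real n \<notin> U"
  shows "\<not> has_unbounded_component U"
proof
  assume "has_unbounded_component U"
  then obtain C where C: "C \<in> components U" "\<not> bounded C"
    by (auto simp: has_unbounded_component_def)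
  have sub: "C \<subseteq> U" and con: "connected C" and ne: "C \<noteq> {}"
    using C in_components_subset in_components_connected in_components_nonempty by blast+
  obtain c where c: "c \<in> C" using ne by blast
  obtain k where k: "k \<ge> nat \<lceil>c\<rceil>" "real k \<notin> U"
    using assms(2) unfolding INFM_nat_le by blast
  obtain x where x: "x \<in> C" "x > real k"
  proof -
    have "\<not> C \<subseteq> {0..real k}" using C(2) bounded_subset[OF bounded_closed_interval] by blast
    then show ?thesis using that sub assms(1) by force
  qed
  have "c \<le> real k" using k(1) by linarith
  then have "real k \<in> C" using connectedD_interval[OF con c x(1)] x(2) by simp
  then show False using sub k(2) by blast
qed

lemma has_unbounded_componentI:
  assumes "{a..} \<subseteq> U"
  shows "has_unbounded_component U"
proof -
  have "{a..} \<subseteq> connected_component_set U a"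
    using assms by (intro connected_component_maximal) auto
  moreover have "\<not> bounded {a..}"
  proof
    assume "bounded {a..}"
    then obtain B where B: "\<forall>x\<in>{a..}. norm x \<le> B" by (auto simp: bounded_iff)
    from B[rule_format, of "max a (\<bar>B\<bar> + 1)"] show False by auto
  qed
  ultimately show ?thesis
    unfolding has_unbounded_component_def components_def
    using assms bounded_subset by (intro bexI[of _ "connected_component_set U a"]) blast+
qed

text \<open>Reduces the convergence of a series of truncated moments to a bound on partial sums at
  one fixed radius.\<close>

lemma summable_integral_dominated:
  fixes g :: "nat \<Rightarrow> 'a \<Rightarrow> real"
  assumes g: "\<And>k. integrable M (g k)" "\<And>k x. x \<in> space M \<Longrightarrow> 0 \<le> g k x"
    and h: "integrable M h" "\<And>n x. x \<in> space M \<Longrightarrow> (\<Sum>k<n. g k x) \<le> h x"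
  shows "summable (\<lambda>k. \<integral>x. g k x \<partial>M)"
proof (rule summableI_nonneg_bounded)
  show "0 \<le> (\<integral>x. g k x \<partial>M)" for k
    using g(2) by (intro integral_nonneg_AE AE_I2)
  show "(\<Sum>k<n. \<integral>x. g k x \<partial>M) \<le> (\<integral>x. h x \<partial>M)" for n
  proof -
    have "(\<Sum>k<n. \<integral>x. g k x \<partial>M) = (\<integral>x. (\<Sum>k<n. g k x) \<partial>M)"
      using g(1) by (simp add: Bochner_Integration.integral_sum)
    also have "\<dots> \<le> (\<integral>x. h x \<partial>M)"
      using g(1) h by (intro integral_mono Bochner_Integration.integrable_sum)
    finally show ?thesis .
  qed
qed

lemma truncated_geometric_sum_inverse:
  fixes a r :: real
  assumes "a > 1" "r > 0"
  shows "(\<Sum>k<n. if r \<le> a ^ k then r / a ^ k else 0) \<le> a / (a - 1)"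
proof -
  let ?s = "\<lambda>n. \<Sum>k<n. if r \<le> a ^ k then r / a ^ k else 0"
  \<comment> \<open>Invariant: once the terms have started, the partial sum together with the
    complete geometric tail from \<open>n\<close> on, which equals
    \<open>a / (a - 1) * (r / a ^ n)\<close>, stays below the bound.\<close>
  have "if r \<le> a ^ n then ?s n + a / (a - 1) * (r / a ^ n) \<le> a / (a - 1) else ?s n = 0" for n
  proof (induction n)
    case 0
    then show ?case using assms mult_left_mono[of r 1 "a / (a - 1)"] by simp
  next
    case (Suc n)
    have pos: "a ^ n > 0" using assms by simp
    have mono: "a ^ n \<le> a ^ Suc n" using assms by simp
    show ?case
    proof (cases "r \<le> a ^ n")
      case True
      have "r / a ^ n + a / (a - 1) * (r / a ^ Suc n) = a / (a - 1) * (r / a ^ n)"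
        using assms pos by (simp add: field_simps)
      then show ?thesis using Suc True mono by simp
    next
      case False
      then have "?s (Suc n) = 0" using Suc by simp
      moreover have "a / (a - 1) * (r / a ^ Suc n) \<le> a / (a - 1) * 1" if "r \<le> a ^ Suc n"
        using that assms pos by (intro mult_left_mono) (auto simp: field_simps)
      ultimately show ?thesis by simp
    qed
  qed
  from this[of n] show ?thesis using assms by (auto split: if_splits simp: add_increasing2 intro: order_trans[rotated])
qed

lemma truncated_geometric_sum:
  fixes a r :: real
  assumes "a > 1" "r > 0"
  shows "(\<Sum>k<n. if a ^ k < r then a ^ k else 0) \<le> a / (a - 1) * r"
proof -
  let ?s = "\<lambda>n. \<Sum>k<n. if a ^ k < r then a ^ k else 0"
  \<comment> \<open>The first bound feeds the second: when the term \<open>a ^ n\<close> is added,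
    the new sum is at most \<open>a / (a - 1) * a ^ n\<close>, and here
    \<open>a ^ n < r\<close>.\<close>
  have "?s n \<le> a ^ n / (a - 1) \<and> ?s n \<le> a / (a - 1) * r" for n
  proof (induction n)
    case 0
    then show ?case using assms by simp
  next
    case (Suc n)
    have eq: "a ^ n / (a - 1) + a ^ n = a / (a - 1) * a ^ n" "a ^ Suc n / (a - 1) = a / (a - 1) * a ^ n"
      using assms by (simp_all add: field_simps)
    have le: "a ^ n / (a - 1) \<le> a ^ Suc n / (a - 1)"
      using assms by (intro divide_right_mono) auto
    show ?case
    proof (cases "a ^ n < r")
      case True
      then have "?s (Suc n) \<le> a / (a - 1) * a ^ n" using Suc eq by simp
      moreover have "a / (a - 1) * a ^ n \<le> a / (a - 1) * r"
        using True assms by (intro mult_left_mono) auto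
      ultimately show ?thesis using eq by linarith
    next
      case False
      then show ?thesis using Suc le by simp
    qed
  qed
  then show ?thesis by blast
qed

lemma power_bracket:
  fixes a x :: real
  assumes "a > 1" "x \<ge> a ^ j"
  obtains k where "k \<ge> j" "a ^ k \<le> x" "x < a ^ Suc k"
proof -
  define K where "K = (LEAST K. x < a ^ K)"
  have ex: "\<exists>K. x < a ^ K" using real_arch_pow[OF assms(1)] by blast
  have K: "x < a ^ K" unfolding K_def by (rule LeastI_ex[OF ex])
  have "a ^ j < a ^ K" using K assms(2) by linarith
  then have "j < K" using assms(1) by simp
  then obtain k where k: "K = Suc k" "k \<ge> j" by (cases K) auto
  have "\<not> x < a ^ k"
    using not_less_Least[of k "\<lambda>K. x < a ^ K"] k by (simp add: K_def[symmetric])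
  then show ?thesis using that[of k] k K by simp
qed

text \<open>If \<open>a ^ k \<le> n < a ^ Suc k\<close>, monotonicity places \<open>V n / n\<close>
  between the values of the quotient at the two powers, up to a factor \<open>a\<close> on either
  side. Ratios tending to 1 remove this factor, and as there are countably many of them, almost sure
  limits along each can be combined.\<close>

lemma tendsto_from_geometric_subsequences:
  fixes V :: "real \<Rightarrow> real"
  assumes mono: "\<And>x y. 0 \<le> x \<Longrightarrow> x \<le> y \<Longrightarrow> V x \<le> V y"
    and nonneg: "\<And>x. 0 \<le> V x"
    and lim: "\<And>j::nat. (\<lambda>k. V ((1 + 1 / real (Suc j)) ^ k) / (1 + 1 / real (Suc j)) ^ k) \<longlonglongrightarrow> m"
  shows "(\<lambda>n. V (real n) / real n) \<longlonglongrightarrow> m"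
proof (rule order_tendstoI)
  have close: "(\<lambda>j. 1 + 1 / real (Suc j)) \<longlonglongrightarrow> 1"
    using tendsto_add[OF tendsto_const LIMSEQ_inverse_real_of_nat, of 1] by (simp add: inverse_eq_divide)
  fix c
  {
    assume c: "c < m"
    show "\<forall>\<^sub>F n in sequentially. c < V (real n) / real n"
    \<comment> \<open>The comparison multiplies \<open>real n < a ^ Suc k\<close> by
      \<open>c\<close>, which requires \<open>c \<ge> 0\<close>; a negative \<open>c\<close> lies
      below every quotient anyway.\<close>
    proof (cases "c < 0")
      case True
      have "c < V (real n) / real n" for n
        using True nonneg[of "real n"] divide_nonneg_nonneg[of "V (real n)" "real n"] by linarith
      then show ?thesis by simp
    next
      case False
      have "(\<lambda>j. (1 + 1 / real (Suc j)) * c) \<longlonglongrightarrow> 1 * c" by (intro tendsto_mult close tendsto_const)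
      from order_tendstoD(2)[OF this, of m] c
      obtain j where j: "(1 + 1 / real (Suc j)) * c < m"
        by (auto simp: eventually_sequentially)
      define a where "a = 1 + 1 / real (Suc j)"
      have a: "a > 1" "a * c < m" using j by (simp_all add: a_def)
      from order_tendstoD(1)[OF lim[of j, folded a_def] a(2)]
      obtain k0 where k0: "\<And>k. k \<ge> k0 \<Longrightarrow> a * c < V (a ^ k) / a ^ k"
        by (auto simp: eventually_sequentially)
      have "c < V (real n) / real n" if n: "n \<ge> nat \<lceil>a ^ k0\<rceil>" for n
      proof -
        have "real n \<ge> a ^ k0" using n by linarith
        from power_bracket[OF a(1) this]
        obtain k where k: "k \<ge> k0" "a ^ k \<le> real n" "real n < a ^ Suc k" .
        have pos: "a ^ k > 0" using a by simp
        have "c * a ^ Suc k < V (a ^ k)" using k0[OF k(1)] pos by (simp add: field_simps)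
        also have "\<dots> \<le> V (real n)" using k pos by (intro mono) auto
        finally have "c * a ^ Suc k < V (real n)" .
        moreover have "c * real n \<le> c * a ^ Suc k" using k False by (intro mult_left_mono) auto
        moreover have "real n > 0" using k pos by linarith
        ultimately show ?thesis by (simp add: field_simps)
      qed
      then show ?thesis by (rule eventually_sequentiallyI)
    qed
  }
  {
    assume c: "m < c"
    have "(\<lambda>j. (1 + 1 / real (Suc j)) * m) \<longlonglongrightarrow> 1 * m" by (intro tendsto_mult close tendsto_const)
    from order_tendstoD(2)[OF this, of c] c
    obtain j where j: "(1 + 1 / real (Suc j)) * m < c"
      by (auto simp: eventually_sequentially)
    define a where "a = 1 + 1 / real (Suc j)"
    have a: "a > 1" "m < c / a" using j by (simp_all add: a_def field_simps)
    from order_tendstoD(2)[OF lim[of j, folded a_def] a(2)]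
    obtain k0 where k0: "\<And>k. k \<ge> k0 \<Longrightarrow> V (a ^ k) / a ^ k < c / a"
      by (auto simp: eventually_sequentially)
    have "V (real n) / real n < c" if n: "n \<ge> nat \<lceil>a ^ k0\<rceil>" for n
    proof -
      have "real n \<ge> a ^ k0" using n by linarith
      from power_bracket[OF a(1) this]
      obtain k where k: "k \<ge> k0" "a ^ k \<le> real n" "real n < a ^ Suc k" .
      have pos: "a ^ k > 0" using a by simp
      have "V (a ^ Suc k) / a ^ Suc k < c / a" using k(1) by (intro k0) simp
      then have *: "V (a ^ Suc k) < c * a ^ k" using pos a by (simp add: field_simps)
      have "c \<ge> 0"
        using * nonneg[of "a ^ Suc k"] pos by (smt (verit) mult_neg_pos)
      have "V (real n) \<le> V (a ^ Suc k)" using k by (intro mono) auto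
      also note *
      also have "c * a ^ k \<le> c * real n" using k \<open>c \<ge> 0\<close> by (intro mult_left_mono) auto
      finally have "V (real n) < c * real n" .
      moreover have "real n > 0" using k pos by linarith
      ultimately show ?thesis by (simp add: field_simps)
    qed
    then show "\<forall>\<^sub>F n in sequentially. V (real n) / real n < c" by (rule eventually_sequentiallyI)
  }
qed

subsection \<open>Void probabilities\<close>

locale boolean_percolation = prob_space M for M :: "'w measure" +
  fixes lam :: real and \<mu> :: "real measure" and P :: "'w \<Rightarrow> (real \<times> real) set"
  assumes lam_pos: "lam > 0"
    and radius_prob: "prob_space \<mu>"
    and sets_radius: "sets \<mu> = sets (restrict_space borel {0<..})"
    and poisson: "poisson_point_process M (scale_measure (ennreal lam) lborel \<Otimes>\<^sub>M \<mu>) P"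
begin

sublocale radius: prob_space \<mu>
  by (rule radius_prob)

definition S :: "(real \<times> real) measure" where
  "S = scale_measure (ennreal lam) lborel \<Otimes>\<^sub>M \<mu>"

lemma space_radius: "space \<mu> = {0<..}"
  using sets_eq_imp_space_eq[OF sets_radius] by (simp add: space_restrict_space)

lemma space_S: "space S = UNIV \<times> {0<..}"
  by (simp add: S_def space_pair_measure space_scale_measure space_radius)

lemma sets_S: "sets S = sets (borel \<Otimes>\<^sub>M \<mu>)"
  unfolding S_def by (intro sets_pair_measure_cong) auto

lemma measurable_ident_radius[measurable]: "(\<lambda>r. r) \<in> borel_measurable \<mu>"
  unfolding measurable_cong_sets[OF sets_radius refl] by (intro measurable_restrict_space1) simp

lemma measurable_fst_S[measurable]: "fst \<in> borel_measurable S"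
proof -
  have "fst \<in> measurable S (scale_measure (ennreal lam) lborel)"
    unfolding S_def by (rule measurable_fst)
  also have "measurable S (scale_measure (ennreal lam) lborel) = borel_measurable S"
    by (intro measurable_cong_sets) auto
  finally show ?thesis .
qed

lemma measurable_snd_S[measurable]: "snd \<in> borel_measurable S"
  using measurable_compose[OF measurable_snd measurable_ident_radius] by (simp add: S_def)

sublocale intensity: sigma_finite_measure "scale_measure (ennreal lam) (lborel :: real measure)"
proof
  obtain A :: "real set set" where A: "countable A" "A \<subseteq> sets lborel" "\<Union>A = space lborel"
      "\<forall>a\<in>A. emeasure lborel a \<noteq> \<infinity>"
    using lborel.sigma_finite_countable by blast
  then show "\<exists>A::real set set. countable A \<and> A \<subseteq> sets (scale_measure (ennreal lam) lborel) \<and>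
      \<Union> A = space (scale_measure (ennreal lam) lborel) \<and>
      (\<forall>a\<in>A. emeasure (scale_measure (ennreal lam) lborel) a \<noteq> \<infinity>)"
    by (intro exI[of _ A]) (auto simp: space_scale_measure ennreal_mult_eq_top_iff)
qed

sublocale intensity_pair: pair_sigma_finite "scale_measure (ennreal lam) (lborel :: real measure)" \<mu> ..

lemma emeasure_S:
  assumes "A \<in> sets S"
  shows "emeasure S A = ennreal lam * (\<integral>\<^sup>+r. emeasure lborel {u. (u, r) \<in> A} \<partial>\<mu>)"
proof -
  have "(\<lambda>r. emeasure (scale_measure (ennreal lam) lborel) ((\<lambda>u. (u, r)) -` A)) \<in> borel_measurable \<mu>"
    using assms unfolding S_def by (rule intensity_pair.measurable_emeasure_Pair2)
  \<comment> \<open>The product measure gives measurability of the scaled slice length; multiplying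
    by \<open>1 / lam\<close> recovers the length itself.\<close>
  then have m: "(\<lambda>r. ennreal (1 / lam) * (ennreal lam * emeasure lborel {u. (u, r) \<in> A})) \<in> borel_measurable \<mu>"
    by (simp add: vimage_def)
  have "ennreal (1 / lam) * (ennreal lam * c) = c" for c
    using lam_pos by (simp add: mult.assoc[symmetric] ennreal_mult'[symmetric])
  with m have "(\<lambda>r. emeasure lborel {u. (u, r) \<in> A}) \<in> borel_measurable \<mu>" by simp
  then show ?thesis
    unfolding S_def intensity_pair.emeasure_pair_measure_alt2[OF assms[unfolded S_def]]
    by (simp add: vimage_def nn_integral_cmult)
qed

definition void :: "(real \<times> real) set \<Rightarrow> 'w set" where
  "void A = {\<omega> \<in> space M. P \<omega> \<inter> A = {}}"

lemma num_points_eq_0_iff: "num_points Q A = 0 \<longleftrightarrow> Q \<inter> A = {}"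
  by (simp add: num_points_def emeasure_count_space_eq_0)

lemma void_alt: "void A = {\<omega> \<in> space M. num_points (P \<omega>) A = of_nat 0}"
  by (simp add: void_def num_points_eq_0_iff)

lemma void_measurable[measurable]: "A \<in> sets S \<Longrightarrow> void A \<in> events"
proof -
  assume "A \<in> sets S"
  then have [measurable]: "(\<lambda>\<omega>. num_points (P \<omega>) A) \<in> borel_measurable M"
    using poisson by (simp add: poisson_point_process_def S_def)
  show ?thesis unfolding void_alt by measurable
qed

lemma void_Un: "void (A \<union> B) = void A \<inter> void B"
  by (auto simp: void_def)

lemma prob_void:
  assumes "A \<in> sets S" "emeasure S A < \<infinity>"
  shows "prob (void A) = exp (- measure S A)"
proof -
  have "\<forall>A\<in>sets S. emeasure S A < \<infinity> \<longrightarrow>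
        (\<forall>k::nat. measure M {\<omega> \<in> space M. num_points (P \<omega>) A = of_nat k} =
           exp (- measure S A) * measure S A ^ k / fact k)"
    using poisson unfolding poisson_point_process_def S_def by (elim conjE)
  from this[rule_format, OF assms, of 0] have "measure M {\<omega> \<in> space M. num_points (P \<omega>) A = of_nat 0} =
      exp (- measure S A) * measure S A ^ 0 / fact 0"
    by simp
  then show ?thesis by (simp add: void_alt)
qed

lemma emeasure_S_integral:
  assumes "A \<in> sets S" "integrable \<mu> g" "\<And>r. r > 0 \<Longrightarrow> 0 \<le> g r"
    and "\<And>r. r > 0 \<Longrightarrow> emeasure lborel {u. (u, r) \<in> A} = ennreal (g r)"
  shows "emeasure S A = ennreal (lam * (\<integral>r. g r \<partial>\<mu>))"
proof -
  have "(\<integral>\<^sup>+r. emeasure lborel {u. (u, r) \<in> A} \<partial>\<mu>) = (\<integral>\<^sup>+r. ennreal (g r) \<partial>\<mu>)"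
    by (intro nn_integral_cong) (simp add: assms(4) space_radius)
  also have "\<dots> = ennreal (\<integral>r. g r \<partial>\<mu>)"
    using assms by (intro nn_integral_eq_integral AE_I2) (auto simp: space_radius)
  finally show ?thesis using lam_pos by (simp add: emeasure_S[OF assms(1)] ennreal_mult')
qed

lemma prob_void_integral:
  assumes "A \<in> sets S" "integrable \<mu> g" "\<And>r. r > 0 \<Longrightarrow> 0 \<le> g r"
    and "\<And>r. r > 0 \<Longrightarrow> emeasure lborel {u. (u, r) \<in> A} = ennreal (g r)"
  shows "prob (void A) = exp (- lam * (\<integral>r. g r \<partial>\<mu>))"
proof -
  have "(\<integral>r. g r \<partial>\<mu>) \<ge> 0"
    using assms(3) by (intro integral_nonneg_AE AE_I2) (auto simp: space_radius)
  then show ?thesis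
    using lam_pos assms(1) emeasure_S_integral[OF assms]
    by (subst prob_void) (simp_all add: Sigma_Algebra.measure_def)
qed

lemma AE_no_points:
  assumes "A \<in> sets S" "emeasure S A = 0"
  shows "AE \<omega> in M. P \<omega> \<inter> A = {}"
proof -
  have "prob (void A) = 1" using prob_void[of A] assms by (simp add: measure_def)
  then have "AE \<omega> in M. \<omega> \<in> void A" using assms by (simp add: prob_eq_1)
  then show ?thesis by eventually_elim (simp add: void_def)
qed

lemma countable_P: "\<omega> \<in> space M \<Longrightarrow> countable (P \<omega>)"
  and P_subset: "\<omega> \<in> space M \<Longrightarrow> P \<omega> \<subseteq> space S"
  using poisson by (simp_all add: poisson_point_process_def S_def)

text \<open>Passing to open intervals changes the occupied set only by a countable set.\<close>

definition covering :: "real set \<Rightarrow> real \<Rightarrow> real \<Rightarrow> (real \<times> real) set" where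
  "covering T a x = {p \<in> space S. snd p \<in> T \<and> a \<le> fst p \<and> fst p < x \<and> x < fst p + snd p}"

lemma sets_covering[measurable]: "T \<in> sets borel \<Longrightarrow> covering T a x \<in> sets S"
proof -
  assume [measurable]: "T \<in> sets borel"
  have "{p \<in> space S. snd p \<in> T} \<in> sets S" by measurable
  moreover have "{p \<in> space S. a \<le> fst p \<and> fst p < x \<and> x < fst p + snd p} \<in> sets S" by measurable
  ultimately have "{p \<in> space S. snd p \<in> T} \<inter>
      {p \<in> space S. a \<le> fst p \<and> fst p < x \<and> x < fst p + snd p} \<in> sets S"
    by (rule sets.Int)
  also have "{p \<in> space S. snd p \<in> T} \<inter>
      {p \<in> space S. a \<le> fst p \<and> fst p < x \<and> x < fst p + snd p} = covering T a x"
    by (auto simp: covering_def)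
  finally show ?thesis .
qed

text \<open>For \<open>T = UNIV\<close> this is the exponent E(rho min x) of the theorem. Other sets
  \<open>T\<close> describe the model thinned to the radii in \<open>T\<close>.\<close>

definition trunc_mean :: "real set \<Rightarrow> real \<Rightarrow> real" where
  "trunc_mean T x = (\<integral>r. indicator T r * min r x \<partial>\<mu>)"

lemma integrable_trunc_mean:
  assumes [measurable]: "T \<in> sets borel" and "x \<ge> 0"
  shows "integrable \<mu> (\<lambda>r. indicator T r * min r x)"
  using \<open>x \<ge> 0\<close>
  by (intro radius.integrable_const_bound[where B = x] AE_I2)
     (auto simp: space_radius indicator_def)

lemma trunc_mean_nonneg: "x \<ge> 0 \<Longrightarrow> trunc_mean T x \<ge> 0"
  unfolding trunc_mean_def by (intro integral_nonneg_AE AE_I2) (auto simp: space_radius)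

lemma emeasure_covering:
  assumes [measurable]: "T \<in> sets borel" and "a \<le> x"
  shows "emeasure S (covering T a x) = ennreal (lam * trunc_mean T (x - a))"
  unfolding trunc_mean_def
proof (intro emeasure_S_integral sets_covering integrable_trunc_mean assms)
  fix r :: real assume r: "r > 0"
  show "0 \<le> indicator T r * min r (x - a)" using r \<open>a \<le> x\<close> by simp
  show "emeasure lborel {u. (u, r) \<in> covering T a x} = ennreal (indicator T r * min r (x - a))"
  proof (cases "r \<in> T")
    case True
    \<comment> \<open>A short radius makes the constraint \<open>a \<le> u\<close> automatic, a long
      one makes \<open>x < u + r\<close> automatic.\<close>
    then have "{u. (u, r) \<in> covering T a x} = (if r \<le> x - a then {x - r<..<x} else {a..<x})"
      using r by (auto simp: covering_def space_S)
    then show ?thesis using True r \<open>a \<le> x\<close> by auto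
  qed (simp add: covering_def)
qed (use \<open>a \<le> x\<close> in auto)

lemma measure_covering:
  assumes "T \<in> sets borel" "a \<le> x"
  shows "measure S (covering T a x) = lam * trunc_mean T (x - a)"
  using assms lam_pos trunc_mean_nonneg[of "x - a" T] by (simp add: measure_def emeasure_covering)

definition vacant_prob :: "real set \<Rightarrow> real \<Rightarrow> real" where
  "vacant_prob T x = exp (- lam * trunc_mean T x)"

lemma prob_void_covering:
  assumes "T \<in> sets borel" "x \<ge> 0"
  shows "prob (void (covering T 0 x)) = vacant_prob T x"
  using assms by (subst prob_void) (simp_all add: emeasure_covering measure_covering vacant_prob_def)

text \<open>If \<open>x\<close> is vacant, then intervals starting to its left do not reach beyond \<open>x\<close>; this is what
  makes vacancy regenerative.\<close>

lemma covering_Un: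
  assumes "0 \<le> x" "x \<le> y"
  shows "covering T 0 x \<union> covering T 0 y = covering T 0 x \<union> covering T x y"
  using assms by (auto simp: covering_def)

lemma covering_disjoint: "covering T 0 x \<inter> covering T x y = {}"
  by (auto simp: covering_def)

text \<open>Once \<open>x\<close> is vacant, \<open>y\<close> only has to avoid intervals starting
  in \<open>{x..<y}\<close>. The two covering sets are disjoint, so their intensities add up and the
  void probability factorises.\<close>

lemma prob_void_covering2:
  assumes [measurable]: "T \<in> sets borel" and "0 \<le> x" "x \<le> y"
  shows "prob (void (covering T 0 x) \<inter> void (covering T 0 y)) = vacant_prob T x * vacant_prob T (y - x)"
proof -
  have fin: "covering T 0 x \<in> fmeasurable S" "covering T x y \<in> fmeasurable S"
    using assms by (auto intro!: fmeasurableI simp: emeasure_covering)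
  have "void (covering T 0 x) \<inter> void (covering T 0 y) = void (covering T 0 x \<union> covering T x y)"
    unfolding void_Un[symmetric] covering_Un[OF assms(2,3)] ..
  moreover have "emeasure S (covering T 0 x \<union> covering T x y) < \<infinity>"
    using fmeasurableD2[OF fmeasurable.Un[OF fin]] by (simp add: top.not_eq_extremum)
  moreover have "measure S (covering T 0 x \<union> covering T x y) = lam * trunc_mean T x + lam * trunc_mean T (y - x)"
    using assms fin by (subst measure_Un_AE) (auto simp: measure_covering covering_disjoint[THEN disjoint_iff[THEN iffD1], rule_format])
  ultimately show ?thesis
    using assms by (simp add: prob_void vacant_prob_def exp_add[symmetric])
qed

definition vacant :: "nat \<Rightarrow> 'w set" where
  "vacant n = void (covering UNIV 0 (real n))"

lemma vacant_measurable[measurable]: "vacant n \<in> events"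
  unfolding vacant_def by measurable

text \<open>When \<open>m\<close> is vacant, the later integers are decided by the points starting
  at \<open>m\<close> or after it. These form the set \<open>B'\<close>, disjoint from the points
  covering \<open>m\<close> and of the same intensity as the unshifted set \<open>B\<close>.\<close>

lemma vacant_regenerative:
  assumes "finite J"
  shows "prob {\<omega> \<in> space M. \<omega> \<in> vacant m \<and> (\<forall>k\<in>J. \<omega> \<in> vacant (m + k))} =
    prob (vacant m) * prob {\<omega> \<in> space M. \<forall>k\<in>J. \<omega> \<in> vacant k}"
proof -
  define B where "B = (\<Union>k\<in>J. covering UNIV 0 (real k))"
  define B' where "B' = (\<Union>k\<in>J. covering UNIV (real m) (real (m + k)))"
  have [measurable]: "B \<in> sets S" "B' \<in> sets S"
    unfolding B_def B'_def using assms by auto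
  have fm: "B \<in> fmeasurable S" "B' \<in> fmeasurable S" "covering UNIV 0 (real m) \<in> fmeasurable S"
    unfolding B_def B'_def using assms
    by (intro fmeasurable.finite_UN fmeasurableI sets_covering; simp add: emeasure_covering)+
  have "emeasure S B' = emeasure S B"
  proof -
    \<comment> \<open>For each radius, the slice of \<open>B'\<close> is the slice of
      \<open>B\<close> translated by \<open>m\<close>.\<close>
    have "emeasure lborel {u. (u, r) \<in> B'} = emeasure lborel {u. (u, r) \<in> B}" for r
    proof -
      have "{u. (u, r) \<in> B'} \<in> sets borel"
        using sets_Pair2[OF \<open>B' \<in> sets S\<close>[unfolded sets_S], of r] by (simp add: vimage_def)
      then have "emeasure (distr lborel borel ((+) (real m))) {u. (u, r) \<in> B'} =
          emeasure lborel {u. (real m + u, r) \<in> B'}"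
        by (simp add: emeasure_distr vimage_def)
      also have "{u. (real m + u, r) \<in> B'} = {u. (u, r) \<in> B}"
        by (auto simp: B_def B'_def covering_def space_S)
      finally show ?thesis by (simp add: lborel_distr_plus)
    qed
    then show ?thesis by (simp add: emeasure_S)
  qed
  then have eq: "measure S B' = measure S B" by (simp add: measure_def)
  have "{\<omega> \<in> space M. \<omega> \<in> vacant m \<and> (\<forall>k\<in>J. \<omega> \<in> vacant (m + k))} = void (covering UNIV 0 (real m) \<union> B')"
  proof -
    have "\<omega> \<in> void (covering UNIV 0 (real m)) \<and> \<omega> \<in> void (covering UNIV 0 (real (m + k))) \<longleftrightarrow>
        \<omega> \<in> void (covering UNIV 0 (real m)) \<and> \<omega> \<in> void (covering UNIV (real m) (real (m + k)))" for k \<omega>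
      using covering_Un[of "real m" "real (m + k)" UNIV] void_Un[of "covering UNIV 0 (real m)"]
      by (metis Int_iff of_nat_0_le_iff le_add1 of_nat_le_iff)
    moreover have "\<omega> \<in> void (covering UNIV 0 (real m) \<union> B') \<longleftrightarrow>
        \<omega> \<in> void (covering UNIV 0 (real m)) \<and> (\<forall>k\<in>J. \<omega> \<in> void (covering UNIV (real m) (real (m + k))))" for \<omega>
      unfolding B'_def void_def by blast
    moreover have "void A \<subseteq> space M" for A by (auto simp: void_def)
    ultimately show ?thesis unfolding vacant_def by blast
  qed
  moreover have "{\<omega> \<in> space M. \<forall>k\<in>J. \<omega> \<in> vacant k} = void B"
    unfolding B_def vacant_def void_def by auto
  moreover have "measure S (covering UNIV 0 (real m) \<union> B') = measure S (covering UNIV 0 (real m)) + measure S B"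
    unfolding eq[symmetric]
    by (intro measure_Un_AE fm AE_I2) (auto simp: B'_def covering_def)
  moreover have "emeasure S (covering UNIV 0 (real m) \<union> B') < \<infinity>" "emeasure S B < \<infinity>"
      "emeasure S (covering UNIV 0 (real m)) < \<infinity>"
    using fmeasurableD2[OF fmeasurable.Un[OF fm(3,2)]] fmeasurableD2[OF fm(1)] fmeasurableD2[OF fm(3)]
    by (simp_all add: top.not_eq_extremum)
  ultimately show ?thesis
    by (simp add: prob_void vacant_def exp_add[symmetric])
qed

subsection \<open>Unbounded components\<close>

lemma trunc_mean_mono:
  assumes "T \<in> sets borel" "0 \<le> x" "x \<le> y"
  shows "trunc_mean T x \<le> trunc_mean T y"
  unfolding trunc_mean_def using assms
  by (intro integral_mono integrable_trunc_mean) (auto simp: indicator_def)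

lemma vacant_prob_antimono: "T \<in> sets borel \<Longrightarrow> 0 \<le> x \<Longrightarrow> x \<le> y \<Longrightarrow> vacant_prob T y \<le> vacant_prob T x"
  using trunc_mean_mono[of T x y] lam_pos by (simp add: vacant_prob_def)

lemma vacant_prob_pos: "vacant_prob T x > 0"
  by (simp add: vacant_prob_def)

text \<open>At a fixed point closed and open intervals agree almost surely; the renewal argument
  needs this simultaneously at all integers.\<close>

lemma AE_no_endpoint: "AE \<omega> in M. \<forall>n::nat. P \<omega> \<inter> {p \<in> space S. fst p = n \<or> fst p + snd p = n} = {}"
  unfolding AE_all_countable
proof (intro allI AE_no_points)
  fix n :: nat
  show *: "{p \<in> space S. fst p = n \<or> fst p + snd p = n} \<in> sets S" by measurable
  have "{u. (u, r) \<in> {p \<in> space S. fst p = n \<or> fst p + snd p = n}} \<subseteq> {real n, real n - r}" for r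
    by auto
  then have "emeasure lborel {u. (u, r) \<in> {p \<in> space S. fst p = n \<or> fst p + snd p = n}} = 0" for r
    by (intro emeasure_lborel_countable countable_finite) (auto intro: finite_subset)
  then show "emeasure S {p \<in> space S. fst p = n \<or> fst p + snd p = n} = 0"
    by (simp add: emeasure_S[OF *])
qed

lemma occupied_set_subset: "\<omega> \<in> space M \<Longrightarrow> occupied_set (P \<omega>) \<subseteq> {0..}"
  by (auto simp: occupied_set_def)

text \<open>Serves both (i), where the integrand is bounded away from 0, and (iii), where divergence
  is assumed.\<close>

lemma AE_not_has_unbounded_component:
  assumes "(\<integral>\<^sup>+x\<in>{0<..}. ennreal (vacant_prob UNIV x) \<partial>lborel) = \<infinity>"
  shows "AE \<omega> in M. \<not> has_unbounded_component (occupied_set (P \<omega>))"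
proof -
  have "(\<Sum>n. ennreal (vacant_prob UNIV (real n))) = \<infinity>"
    using antimono_integral_bounds(2)[of "vacant_prob UNIV"] vacant_prob_antimono[of UNIV] assms by (simp add: top_unique)
  then have "\<not> summable (\<lambda>n. vacant_prob UNIV (real n))"
    using ennreal_suminf_neq_top[of "\<lambda>n. vacant_prob UNIV (real n)"] vacant_prob_pos[THEN less_imp_le] by auto
  then have "\<not> summable (\<lambda>n. prob (vacant n))" by (simp add: vacant_def prob_void_covering)
  then have "AE \<omega> in M. \<exists>\<^sub>\<infinity>n. \<omega> \<in> vacant n"
    by (intro regenerative_events_infinitely_often vacant_measurable vacant_regenerative)
  with AE_no_endpoint AE_space show ?thesis
  proof eventually_elim
    case (elim \<omega>)
    have "real n \<notin> occupied_set (P \<omega>)" if "\<omega> \<in> vacant n" for n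
    proof
      assume "real n \<in> occupied_set (P \<omega>)"
      then obtain u r where "(u, r) \<in> P \<omega>" "0 \<le> u" "u \<le> real n" "real n \<le> u + r"
        by (auto simp: occupied_set_def)
      moreover have "(u, r) \<in> space S" using calculation(1) P_subset[OF elim(2)] by blast
      moreover have "u \<noteq> real n" "u + r \<noteq> real n"
        using elim(1)[rule_format, of n] calculation by auto
      ultimately have "(u, r) \<in> P \<omega> \<inter> covering UNIV 0 (real n)" by (auto simp: covering_def)
      then show False using that by (auto simp: vacant_def void_def)
    qed
    then have "\<exists>\<^sub>\<infinity>n. real n \<notin> occupied_set (P \<omega>)"
      using elim(3) by (rule INFM_mono[rotated])
    then show ?case using occupied_set_subset[OF elim(2)] by (intro not_has_unbounded_component)
  qed
qed

lemma AE_has_unbounded_component: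
  assumes "(\<integral>\<^sup>+x\<in>{0<..}. ennreal (vacant_prob UNIV x) \<partial>lborel) < \<infinity>"
  shows "AE \<omega> in M. has_unbounded_component (occupied_set (P \<omega>))"
proof -
  \<comment> \<open>\<open>D n\<close> asks for one single interval containing
    \<open>{n..n + 1}\<close>, which turns coverage of a continuum of points into one void
    event.\<close>
  define D where "D n = {p \<in> space S. 0 \<le> fst p \<and> fst p \<le> real n \<and> real (Suc n) \<le> fst p + snd p}" for n
  have D[measurable]: "D n \<in> sets S" for n unfolding D_def by measurable
  have le: "prob (void (D n)) \<le> exp lam * vacant_prob UNIV (real (Suc n))" for n
  proof -
    \<comment> \<open>The admissible starting points form an interval of this length. It falls short
      of the truncated radius by at most 1, which costs the factor \<open>exp lam\<close>.\<close>
    define g where "g r = max 0 (min (real (Suc n)) r - 1)" for r :: real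
    have int: "integrable \<mu> g"
      unfolding g_def by (intro radius.integrable_const_bound[where B = n] AE_I2) auto
    have "emeasure lborel {u. (u, r) \<in> D n} = ennreal (g r)" if "r > 0" for r
    proof -
      have "{u. (u, r) \<in> D n} = {max 0 (real (Suc n) - r)..real n}"
        using that by (auto simp: D_def space_S)
      then show ?thesis by (auto simp: g_def max_def min_def)
    qed
    then have eq: "prob (void (D n)) = exp (- lam * (\<integral>r. g r \<partial>\<mu>))"
      by (intro prob_void_integral D int) (auto simp: g_def)
    have "trunc_mean UNIV (real (Suc n)) - 1 = (\<integral>r. min r (real (Suc n)) - 1 \<partial>\<mu>)"
      using integrable_trunc_mean[of UNIV "real (Suc n)"] by (simp add: trunc_mean_def radius.prob_space)
    also have "\<dots> \<le> (\<integral>r. g r \<partial>\<mu>)"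
      using integrable_trunc_mean[of UNIV "real (Suc n)"]
      by (intro integral_mono int) (auto simp: g_def)
    finally have "lam * (trunc_mean UNIV (real (Suc n)) - 1) \<le> lam * (\<integral>r. g r \<partial>\<mu>)"
      using lam_pos by (intro mult_left_mono) auto
    then show ?thesis unfolding eq vacant_prob_def exp_add[symmetric] by (simp add: right_diff_distrib)
  qed
  have sm: "summable (\<lambda>n. exp lam * vacant_prob UNIV (real (Suc n)))"
  proof (intro summable_mult summable_suminf_not_top)
    have "(\<Sum>n. ennreal (vacant_prob UNIV (real (Suc n)))) \<le> (\<integral>\<^sup>+x\<in>{0<..}. ennreal (vacant_prob UNIV x) \<partial>lborel)"
      by (intro antimono_integral_bounds(1) vacant_prob_antimono) auto
    also note assms
    finally show "(\<Sum>n. ennreal (vacant_prob UNIV (real (Suc n)))) \<noteq> top" by simp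
  qed (simp add: vacant_prob_pos less_imp_le)
  have "summable (\<lambda>n. prob (void (D n)))"
  proof (rule summable_comparison_test'[OF sm])
    show "norm (prob (void (D n))) \<le> exp lam * vacant_prob UNIV (real (Suc n))" for n
      using le[of n] by simp
  qed
  then have "AE \<omega> in M. eventually (\<lambda>n. \<omega> \<in> space M - void (D n)) sequentially"
    by (intro borel_cantelli_AE1) (auto simp: emeasure_eq_measure)
  then show ?thesis
  proof eventually_elim
    case (elim \<omega>)
    then obtain m where m: "\<And>n. n \<ge> m \<Longrightarrow> \<omega> \<in> space M - void (D n)"
      by (auto simp: eventually_sequentially)
    have "{real m..} \<subseteq> occupied_set (P \<omega>)"
    proof
      fix x assume "x \<in> {real m..}"
      then have x: "real m \<le> x" by simp
      define n where "n = nat \<lfloor>x\<rfloor>"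
      have n: "n \<ge> m" "real n \<le> x" "x \<le> real (Suc n)" using x unfolding n_def by linarith+
      then obtain u r where "(u, r) \<in> P \<omega>" "(u, r) \<in> D n" using m[of n] by (auto simp: void_def)
      then show "x \<in> occupied_set (P \<omega>)" using n
        unfolding occupied_set_def by (intro UN_I[of "(u, r)"]) (auto simp: D_def)
    qed
    then show ?case by (rule has_unbounded_componentI)
  qed
qed

section \<open>Expected size of the component of 1\<close>

lemma component_size_ge:
  assumes "\<omega> \<in> space M" "(u, r) \<in> P \<omega>" "0 \<le> u" "u \<le> 1" "1 \<le> u + r"
  shows "ennreal r \<le> component_size (occupied_set (P \<omega>)) 1"
proof -
  have r: "r > 0" using P_subset[OF assms(1)] assms(2) by (auto simp: space_S)
  have "{u..u + r} \<subseteq> connected_component_set (occupied_set (P \<omega>)) 1"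
    using assms by (intro connected_component_maximal) (auto simp: occupied_set_def)
  then have "emeasure lborel {u..u + r} \<le> component_size (occupied_set (P \<omega>)) 1"
    unfolding component_size_def
    by (intro emeasure_mono)
       (auto intro!: real_interval_borel_measurable simp: is_interval_connected_1)
  then show ?thesis using r by simp
qed

text \<open>Each event "some interval of length at least \<open>n + 1\<close> starts in [0, 1]" has
  probability at least a constant times P(rho >= n + 1), and the size is at least the number of
  these events that occur. The tail sum of rho diverges with its mean.\<close>

lemma expected_component_size_infinite:
  assumes "(\<integral>\<^sup>+r. ennreal r \<partial>\<mu>) = \<infinity>"
  shows "(\<integral>\<^sup>+\<omega>. component_size (occupied_set (P \<omega>)) 1 \<partial>M) = \<infinity>"
proof -
  \<comment> \<open>The shift to \<open>Suc n\<close> keeps the length at least 1, so that an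
    interval starting in [0, 1] contains 1.\<close>
  define B where "B n = {p \<in> space S. 0 \<le> fst p \<and> fst p \<le> 1 \<and> real (Suc n) \<le> snd p}" for n
  have B[measurable]: "B n \<in> sets S" for n unfolding B_def by measurable
  define a :: "nat \<Rightarrow> real" where "a n = (\<integral>r. indicator {real (Suc n)..} r \<partial>\<mu>)" for n
  have int: "integrable \<mu> (indicator {real (Suc n)..} :: real \<Rightarrow> real)" for n
    by (intro radius.integrable_const_bound[where B = 1] AE_I2) (auto simp: indicator_def)
  have a: "0 \<le> a n" "a n \<le> 1" for n
    unfolding a_def using integral_mono[OF int, of "\<lambda>_. 1"]
    by (auto simp: radius.prob_space indicator_def intro!: integral_nonneg_AE)
  have void_eq: "prob (void (B n)) = exp (- lam * a n)" for n
    unfolding a_def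
  proof (intro prob_void_integral B int)
    fix r :: real assume "r > 0"
    then have "{u. (u, r) \<in> B n} = (if real (Suc n) \<le> r then {0..1} else {})"
      by (auto simp: B_def space_S)
    then show "emeasure lborel {u. (u, r) \<in> B n} = ennreal (indicator {real (Suc n)..} r)"
      by (simp add: indicator_def)
  qed auto
  have hit: "prob (space M - void (B n)) \<ge> lam / (1 + lam) * a n" for n
  proof -
    \<comment> \<open>This is 1 - exp (-x) >= x / (1 + x) at \<open>x = lam * a n\<close>; as
      \<open>a n \<le> 1\<close>, the denominator is then replaced by
      \<open>1 + lam\<close>.\<close>
    have "1 + lam * a n \<le> exp (lam * a n)" by (rule exp_ge_add_one_self)
    then have "exp (- lam * a n) \<le> 1 / (1 + lam * a n)"
      using a[of n] lam_pos by (simp add: exp_minus field_simps add_pos_nonneg)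
    also have "\<dots> = 1 - lam * a n / (1 + lam * a n)"
      using a[of n] lam_pos by (simp add: field_simps add_pos_nonneg add_nonneg_eq_0_iff)
    also have "\<dots> \<le> 1 - lam * a n / (1 + lam)"
      using a[of n] lam_pos by (intro diff_left_mono divide_left_mono mult_pos_pos)
        (auto intro: add_pos_nonneg mult_left_le)
    finally show ?thesis by (simp add: prob_compl void_eq)
  qed
  have "(\<Sum>n. ennreal (a n)) = \<infinity>"
  proof -
    \<comment> \<open>The sum counts the positive integers up to \<open>r\<close>, that is, the
      integer part of \<open>r\<close>.\<close>
    have "ennreal r \<le> 1 + (\<Sum>n. indicator {real (Suc n)..} r)" if "r > 0" for r :: real
    proof -
      have "ennreal r \<le> ennreal (1 + real (nat \<lfloor>r\<rfloor>))" using that by (intro ennreal_leI) linarith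
      also have "\<dots> = 1 + (\<Sum>n<nat \<lfloor>r\<rfloor>. 1)"
        by (simp add: ennreal_of_nat_eq_real_of_nat)
      also have "(\<Sum>n<nat \<lfloor>r\<rfloor>. 1) \<le> (\<Sum>n<nat \<lfloor>r\<rfloor>. indicator {real (Suc n)..} r :: ennreal)"
      proof (intro sum_mono)
        fix n assume "n \<in> {..<nat \<lfloor>r\<rfloor>}"
        then have "real (Suc n) \<le> r" by (auto; linarith)
        then show "1 \<le> (indicator {real (Suc n)..} r :: ennreal)" by simp
      qed
      also have "\<dots> \<le> (\<Sum>n. indicator {real (Suc n)..} r)"
        by (intro sum_le_suminf) auto
      finally show ?thesis by (simp add: add_left_mono)
    qed
    then have "(\<integral>\<^sup>+r. ennreal r \<partial>\<mu>) \<le> (\<integral>\<^sup>+r. 1 + (\<Sum>n. indicator {real (Suc n)..} r) \<partial>\<mu>)"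
      by (intro nn_integral_mono) (auto simp: space_radius)
    also have "\<dots> = 1 + (\<Sum>n. \<integral>\<^sup>+r. indicator {real (Suc n)..} r \<partial>\<mu>)"
      by (subst nn_integral_add; simp add: nn_integral_suminf radius.emeasure_space_1)
    also have "(\<lambda>n. \<integral>\<^sup>+r. indicator {real (Suc n)..} r \<partial>\<mu>) = (\<lambda>n. ennreal (a n))"
      unfolding a_def using nn_integral_eq_integral[OF int] by (simp add: ennreal_indicator)
    finally show ?thesis using assms by (simp add: top_unique)
  qed
  then have "\<infinity> = ennreal (lam / (1 + lam)) * (\<Sum>n. ennreal (a n))"
    using lam_pos by (simp add: ennreal_mult_eq_top_iff)
  also have "\<dots> = (\<Sum>n. ennreal (lam / (1 + lam) * a n))"
    using lam_pos a
    by (subst ennreal_suminf_cmult[symmetric], intro suminf_cong ennreal_mult[symmetric]) auto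
  also have "\<dots> \<le> (\<Sum>n. emeasure M (space M - void (B n)))"
    unfolding emeasure_eq_measure using hit by (intro suminf_le ennreal_leI) auto
  also have "\<dots> = (\<Sum>n. \<integral>\<^sup>+\<omega>. indicator (space M - void (B n)) \<omega> \<partial>M)"
    by simp
  also have "\<dots> = (\<integral>\<^sup>+\<omega>. (\<Sum>n. indicator (space M - void (B n)) \<omega>) \<partial>M)"
    by (intro nn_integral_suminf[symmetric]) auto
  also have "\<dots> \<le> (\<integral>\<^sup>+\<omega>. component_size (occupied_set (P \<omega>)) 1 \<partial>M)"
  \<comment> \<open>The comparison is pointwise: measurable indicators bound the component size from
    below, so the argument bypasses measurability of the latter.\<close>
  proof (intro nn_integral_mono)
    fix \<omega> assume \<omega>: "\<omega> \<in> space M"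
    show "(\<Sum>n. indicator (space M - void (B n)) \<omega>) \<le> component_size (occupied_set (P \<omega>)) 1"
      unfolding suminf_eq_SUP
    proof (intro SUP_least)
      fix k
      show "(\<Sum>n<k. indicator (space M - void (B n)) \<omega>) \<le> component_size (occupied_set (P \<omega>)) 1"
      \<comment> \<open>A hit of \<open>B k\<close> provides a radius of at least
        \<open>k + 1\<close>, which already dominates all \<open>k + 1\<close> indicators; without a
        hit the last indicator vanishes.\<close>
      proof (induction k)
        case (Suc k)
        show ?case
        proof (cases "\<omega> \<in> void (B k)")
          case True
          then show ?thesis using Suc.IH by simp
        next
          case False
          then obtain u r where p: "(u, r) \<in> P \<omega>" "(u, r) \<in> B k" using \<omega> by (auto simp: void_def)
          have "(\<Sum>n<Suc k. indicator (space M - void (B n)) \<omega>) \<le> (\<Sum>n<Suc k. 1 :: ennreal)"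
            by (intro sum_mono) (auto simp: indicator_def)
          also have "\<dots> = ennreal (real (Suc k))" by (simp add: ennreal_of_nat_eq_real_of_nat)
          also have "\<dots> \<le> ennreal r" using p by (intro ennreal_leI) (auto simp: B_def)
          also have "\<dots> \<le> component_size (occupied_set (P \<omega>)) 1"
            using p by (intro component_size_ge[OF \<omega>]) (auto simp: B_def)
          finally show ?thesis .
        qed
      qed simp
    qed
  qed
  finally show ?thesis by (simp add: top_unique)
qed

subsection \<open>The vacant fraction\<close>

definition vacancy :: "real set \<Rightarrow> real \<Rightarrow> 'w \<Rightarrow> real" where
  "vacancy T x \<omega> = indicator (void (covering T 0 x)) \<omega>"

lemma vacancy_bounds: "0 \<le> vacancy T x \<omega>" "vacancy T x \<omega> \<le> 1"
  by (auto simp: vacancy_def indicator_def)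

text \<open>Since the intervals are open, coverage of \<open>x\<close> is witnessed by one of countably many
  events indexed by rational neighbourhoods of \<open>x\<close>.\<close>

lemma sets_vacancy:
  assumes [measurable]: "T \<in> sets borel"
  shows "{p \<in> space (borel \<Otimes>\<^sub>M M). snd p \<in> void (covering T 0 (fst p))} \<in> sets (borel \<Otimes>\<^sub>M M)"
proof -
  define Q where "Q a b = {p \<in> space S. snd p \<in> T} \<inter>
    {p \<in> space S. 0 \<le> fst p \<and> fst p \<le> a \<and> b \<le> fst p + snd p}" for a b :: real
  have Q: "Q a b \<in> sets S" for a b
    unfolding Q_def by (intro sets.Int; measurable)
  define Z where "Z = (\<Union>a\<in>\<rat>. \<Union>b\<in>\<rat>. {a<..<b} \<times> (space M - void (Q a b)))"
  have "Z \<in> sets (borel \<Otimes>\<^sub>M M)"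
    unfolding Z_def by (intro sets.countable_UN'' countable_rat pair_measureI sets.Diff void_measurable Q) auto
  moreover have "(x, \<omega>) \<in> Z \<longleftrightarrow> \<omega> \<in> space M \<and> \<omega> \<notin> void (covering T 0 x)" for x \<omega>
  proof
    assume "(x, \<omega>) \<in> Z"
    then obtain a b where ab: "a < x" "x < b" "\<omega> \<in> space M" "\<omega> \<notin> void (Q a b)"
      by (auto simp: Z_def)
    moreover have "Q a b \<subseteq> covering T 0 x" using ab by (auto simp: Q_def covering_def)
    ultimately show "\<omega> \<in> space M \<and> \<omega> \<notin> void (covering T 0 x)" unfolding void_def by blast
  next
    assume *: "\<omega> \<in> space M \<and> \<omega> \<notin> void (covering T 0 x)"
    then obtain u r where p: "(u, r) \<in> P \<omega>" "(u, r) \<in> covering T 0 x" by (auto simp: void_def)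
    then have "u < x" "x < u + r" by (auto simp: covering_def)
    then obtain a b where "a \<in> \<rat>" "u < a" "a < x" "b \<in> \<rat>" "x < b" "b < u + r"
      using Rats_dense_in_real by meson
    moreover have "(u, r) \<in> Q a b" using calculation p by (auto simp: Q_def covering_def)
    then have "\<omega> \<notin> void (Q a b)" using p by (auto simp: void_def)
    ultimately show "(x, \<omega>) \<in> Z"
      using * unfolding Z_def by (intro UN_I[of a] UN_I[of b]) auto
  qed
  then have "{p \<in> space (borel \<Otimes>\<^sub>M M). snd p \<in> void (covering T 0 (fst p))} = space (borel \<Otimes>\<^sub>M M) - Z"
    by (auto simp: space_pair_measure void_def)
  ultimately show ?thesis by simp
qed

text \<open>Measurability jointly in position and outcome, as Fubini's theorem requires for the
  vacant length.\<close>

lemma measurable_vacancy[measurable (raw)]: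
  assumes [measurable]: "T \<in> sets borel" "X \<in> borel_measurable N" "Y \<in> measurable N M"
  shows "(\<lambda>w. vacancy T (X w) (Y w)) \<in> borel_measurable N"
proof -
  have "(\<lambda>p. vacancy T (fst p) (snd p)) \<in> borel_measurable (borel \<Otimes>\<^sub>M M)"
  proof (subst measurable_cong)
    show "(indicator {p \<in> space (borel \<Otimes>\<^sub>M M). snd p \<in> void (covering T 0 (fst p))} :: _ \<Rightarrow> real)
      \<in> borel_measurable (borel \<Otimes>\<^sub>M M)"
      by (intro borel_measurable_indicator sets_vacancy assms)
  qed (auto simp: vacancy_def indicator_def)
  moreover have "(\<lambda>w. (X w, Y w)) \<in> measurable N (borel \<Otimes>\<^sub>M M)" by measurable
  ultimately have "(\<lambda>w. vacancy T (fst (X w, Y w)) (snd (X w, Y w))) \<in> borel_measurable N"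
    by (rule measurable_compose_rev)
  then show ?thesis by simp
qed

section \<open>Second moment of the vacant length\<close>

definition vacant_length :: "real set \<Rightarrow> real \<Rightarrow> 'w \<Rightarrow> real" where
  "vacant_length T L \<omega> = measure lborel {x \<in> {0..L}. \<omega> \<in> void (covering T 0 x)}"

definition mean_radius :: "real set \<Rightarrow> real" where
  "mean_radius T = (\<integral>r. indicator T r * r \<partial>\<mu>)"

lemma trunc_mean_le_mean_radius:
  assumes [measurable]: "T \<in> sets borel" and "integrable \<mu> (\<lambda>r. indicator T r * r)" "0 \<le> x"
  shows "trunc_mean T x \<le> mean_radius T"
  unfolding trunc_mean_def mean_radius_def using assms
  by (intro integral_mono integrable_trunc_mean) (auto simp: indicator_def)

lemma exp_neg_diff_le:
  fixes a b :: real
  assumes "0 \<le> a" "a \<le> b"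
  shows "exp (- a) - exp (- b) \<le> b - a"
proof -
  have "exp (- a) - exp (- b) = exp (- a) * (1 - exp (- (b - a)))"
    by (simp add: algebra_simps flip: exp_add)
  also have "\<dots> \<le> 1 * (b - a)"
  proof (intro mult_mono)
    show "1 - exp (- (b - a)) \<le> b - a" using exp_ge_add_one_self[of "- (b - a)"] by linarith
  qed (use assms in auto)
  finally show ?thesis by simp
qed

text \<open>Centring is at the limiting vacancy probability \<open>m\<close>, which bounds all
  vacancy probabilities from below. With p for \<open>vacant_prob T\<close> and x <= y, the renewal
  product turns the expectation into p(x) (p(y - x) - m) - m (p(y) - m), hence at most p(y - x) - m.
  This is at most \<open>lam\<close> times the mean excess of the radius over y - x.\<close>

lemma vacancy_covariance:
  assumes [measurable]: "T \<in> sets borel" and T: "T \<subseteq> {..K}" and xy: "0 \<le> x" "0 \<le> y"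
  defines "m \<equiv> exp (- lam * mean_radius T)"
  shows "expectation (\<lambda>\<omega>. (vacancy T x \<omega> - m) * (vacancy T y \<omega> - m)) \<le>
    lam * (\<integral>r. indicator T r * r * indicator {\<bar>x - y\<bar>..} r \<partial>\<mu>)"
  using xy
proof (induction x y rule: linorder_wlog)
  case (sym x y)
  have "expectation (\<lambda>\<omega>. (vacancy T x \<omega> - m) * (vacancy T y \<omega> - m)) =
      expectation (\<lambda>\<omega>. (vacancy T y \<omega> - m) * (vacancy T x \<omega> - m))"
    by (intro Bochner_Integration.integral_cong) (auto simp: mult.commute)
  then show ?case using sym by (simp add: abs_minus_commute)
next
  case (le x y)
  have int: "integrable \<mu> (\<lambda>r. indicator T r * r)"
    using T by (intro radius.integrable_const_bound[where B = "\<bar>K\<bar>"] AE_I2)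
      (auto simp: space_radius indicator_def)
  have int2: "integrable \<mu> (\<lambda>r. indicator T r * r * indicator {y - x..} r)"
    using T by (intro radius.integrable_const_bound[where B = "\<bar>K\<bar>"] AE_I2)
      (auto simp: space_radius indicator_def)
  have V: "integrable M (vacancy T x)" "expectation (vacancy T x) = vacant_prob T x" if "0 \<le> x" for x
    using that prob_void_covering[of T x] unfolding vacancy_def
    by (auto simp: emeasure_eq_measure)
  have VV: "integrable M (\<lambda>\<omega>. vacancy T x \<omega> * vacancy T y \<omega>)"
      "expectation (\<lambda>\<omega>. vacancy T x \<omega> * vacancy T y \<omega>) = vacant_prob T x * vacant_prob T (y - x)"
    using prob_void_covering2[of T x y] le unfolding vacancy_def indicator_inter_arith[symmetric]
    by (auto simp: emeasure_eq_measure)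
  have m: "m \<le> vacant_prob T z" if "0 \<le> z" for z
    using trunc_mean_le_mean_radius[OF _ int that] lam_pos by (simp add: m_def vacant_prob_def)
  have v1: "vacant_prob T z \<le> 1" if "0 \<le> z" for z
    using trunc_mean_nonneg[OF that, of T] lam_pos by (simp add: vacant_prob_def)
  have "expectation (\<lambda>\<omega>. (vacancy T x \<omega> - m) * (vacancy T y \<omega> - m)) =
      expectation (\<lambda>\<omega>. vacancy T x \<omega> * vacancy T y \<omega> - m * vacancy T x \<omega> - m * vacancy T y \<omega> + m * m)"
    by (simp add: algebra_simps)
  also have "\<dots> = vacant_prob T x * vacant_prob T (y - x) - m * vacant_prob T x - m * vacant_prob T y + m * m"
    using V[of x] V[of y] VV le by (simp add: prob_space)
  also have "\<dots> = vacant_prob T x * (vacant_prob T (y - x) - m) - m * (vacant_prob T y - m)"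
    by (simp add: algebra_simps)
  also have "\<dots> \<le> 1 * (vacant_prob T (y - x) - m) - 0"
    using le m[of "y - x"] m[of y] v1[of x]
    by (intro diff_mono mult_right_mono mult_nonneg_nonneg) (auto simp: m_def)
  also have "\<dots> \<le> lam * mean_radius T - lam * trunc_mean T (y - x)"
    using exp_neg_diff_le[of "lam * trunc_mean T (y - x)" "lam * mean_radius T"]
      trunc_mean_nonneg[of "y - x" T] trunc_mean_le_mean_radius[OF _ int, of "y - x"] lam_pos le
    by (simp add: vacant_prob_def m_def)
  also have "\<dots> = lam * (\<integral>r. indicator T r * r - indicator T r * min r (y - x) \<partial>\<mu>)"
    using int integrable_trunc_mean[of T "y - x"] le
    by (simp add: mean_radius_def trunc_mean_def right_diff_distrib)
  \<comment> \<open>The excess of \<open>r\<close> over \<open>y - x\<close> is 0 for short radii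
    and at most \<open>r\<close> for the others.\<close>
  also have "\<dots> \<le> lam * (\<integral>r. indicator T r * r * indicator {\<bar>x - y\<bar>..} r \<partial>\<mu>)"
    using int integrable_trunc_mean[of T "y - x"] le lam_pos int2
    by (intro mult_left_mono integral_mono Bochner_Integration.integrable_diff)
       (auto simp: indicator_def space_radius abs_if)
  finally show ?case .
qed

text \<open>The square is a double integral of centred vacancies over the square of side
  \<open>L\<close>. After the covariance bound, a radius \<open>r\<close> contributes
  \<open>r\<close> times the area of the strip of points at distance at most \<open>r\<close>
  between coordinates, which is at most \<open>2 * r * L\<close>.\<close>

lemma vacant_length_second_moment:
  assumes [measurable]: "T \<in> sets borel" and T: "T \<subseteq> {..K}" and L: "0 \<le> L"
  defines "m \<equiv> exp (- lam * mean_radius T)"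
  shows "vacant_length T L \<in> borel_measurable M"
    and "integrable M (\<lambda>\<omega>. (vacant_length T L \<omega> - L * m)\<^sup>2)"
    and "expectation (\<lambda>\<omega>. (vacant_length T L \<omega> - L * m)\<^sup>2) \<le>
      2 * lam * L * (\<integral>r. indicator T r * r\<^sup>2 \<partial>\<mu>)"
proof -
  \<comment> \<open>Restricting Lebesgue measure to \<open>{0..L}\<close> makes all product measures
    finite, so boundedness gives the integrability needed for Fubini.\<close>
  define Q where "Q = restrict_space lborel {0..L}"
  have spQ: "space Q = {0..L}" by (simp add: Q_def space_restrict_space)
  have mQ: "(\<lambda>x. x) \<in> borel_measurable Q"
    unfolding Q_def by (intro measurable_restrict_space1) simp
  have emQ: "emeasure Q (space Q) = ennreal L"
    unfolding spQ using L by (simp add: Q_def emeasure_restrict_space)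
  then interpret Q: finite_measure Q by (intro finite_measureI) simp
  have measQ: "measure Q (space Q) = L" using emQ L by (simp add: Sigma_Algebra.measure_def)
  interpret QQ: pair_sigma_finite Q Q ..
  interpret Q2: finite_measure "Q \<Otimes>\<^sub>M Q" by (intro finite_measure_pair_measure Q.finite_measure_axioms)
  interpret Q2M: pair_sigma_finite "Q \<Otimes>\<^sub>M Q" M ..
  interpret Q2M': finite_measure "(Q \<Otimes>\<^sub>M Q) \<Otimes>\<^sub>M M"
    by (intro finite_measure_pair_measure Q2.finite_measure_axioms finite_measure_axioms)
  interpret Q2r: pair_sigma_finite "Q \<Otimes>\<^sub>M Q" \<mu> ..
  interpret Q2r': finite_measure "(Q \<Otimes>\<^sub>M Q) \<Otimes>\<^sub>M \<mu>"
    by (intro finite_measure_pair_measure Q2.finite_measure_axioms radius.finite_measure_axioms)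
  have [measurable]: "fst \<in> borel_measurable (Q \<Otimes>\<^sub>M N)" "snd \<in> borel_measurable (N \<Otimes>\<^sub>M Q)" for N :: "'c measure"
    using measurable_compose[OF measurable_fst mQ, of N] measurable_compose[OF measurable_snd mQ, of N]
    by simp_all
  have [measurable]: "(\<lambda>p. fst (fst p)) \<in> borel_measurable ((Q \<Otimes>\<^sub>M Q) \<Otimes>\<^sub>M N)"
      "(\<lambda>p. snd (fst p)) \<in> borel_measurable ((Q \<Otimes>\<^sub>M Q) \<Otimes>\<^sub>M N)" for N :: "'c measure"
    by (rule measurable_compose[OF measurable_fst], measurable)+
  note mQ[measurable]
  have m: "0 \<le> m" "m \<le> 1"
  proof -
    have "0 \<le> mean_radius T"
      unfolding mean_radius_def by (intro integral_nonneg_AE AE_I2) (auto simp: space_radius)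
    then show "0 \<le> m" "m \<le> 1" using lam_pos by (simp_all add: m_def)
  qed
  define d where "d x \<omega> = vacancy T x \<omega> - m" for x \<omega>
  have d: "\<bar>d x \<omega>\<bar> \<le> 1" for x \<omega>
    using vacancy_bounds[of T x \<omega>] m by (auto simp: d_def)
  have dd: "\<bar>d x \<omega> * d y \<omega>\<bar> \<le> 1" for x y \<omega>
    using d[of x \<omega>] d[of y \<omega>] by (simp add: abs_mult mult_le_one)
  have dQ[measurable]: "(\<lambda>x. d x \<omega>) \<in> borel_measurable Q" if "\<omega> \<in> space M" for \<omega>
    using that unfolding d_def by measurable
  have len: "vacant_length T L \<omega> = (\<integral>x. vacancy T x \<omega> \<partial>Q)" if "\<omega> \<in> space M" for \<omega>
  proof -
    have "vacant_length T L \<omega> = measure Q {x \<in> space Q. \<omega> \<in> void (covering T 0 x)}"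
      unfolding vacant_length_def spQ unfolding Q_def by (subst measure_restrict_space) auto
    also have "\<dots> = (\<integral>x. indicator {x \<in> space Q. \<omega> \<in> void (covering T 0 x)} x \<partial>Q)"
      by (auto intro!: arg_cong[where f = "measure Q"])
    also have "\<dots> = (\<integral>x. vacancy T x \<omega> \<partial>Q)"
      by (intro Bochner_Integration.integral_cong) (auto simp: vacancy_def indicator_def)
    finally show ?thesis .
  qed
  show "vacant_length T L \<in> borel_measurable M"
  proof (subst measurable_cong[OF len])
    have "(\<lambda>p. vacancy T (snd p) (fst p)) \<in> borel_measurable (M \<Otimes>\<^sub>M Q)" by measurable
    then show "(\<lambda>\<omega>. \<integral>x. vacancy T x \<omega> \<partial>Q) \<in> borel_measurable M"
      by (intro Q.borel_measurable_lebesgue_integral) (simp add: case_prod_unfold)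
  qed
  have sq: "(vacant_length T L \<omega> - L * m)\<^sup>2 = (\<integral>p. d (fst p) \<omega> * d (snd p) \<omega> \<partial>(Q \<Otimes>\<^sub>M Q))"
    if \<omega>: "\<omega> \<in> space M" for \<omega>
  proof -
    have int: "integrable Q (\<lambda>x. vacancy T x \<omega>)"
      using \<omega> by (intro Q.integrable_const_bound[where B = 1] AE_I2) (auto simp: vacancy_bounds)
    have "integrable (Q \<Otimes>\<^sub>M Q) (\<lambda>p. d (fst p) \<omega> * d (snd p) \<omega>)"
      using \<omega> dd unfolding d_def by (intro Q2.integrable_const_bound[where B = 1] AE_I2) auto
    then have "(\<integral>p. d (fst p) \<omega> * d (snd p) \<omega> \<partial>(Q \<Otimes>\<^sub>M Q)) = (\<integral>x. (\<integral>y. d x \<omega> * d y \<omega> \<partial>Q) \<partial>Q)"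
      by (subst QQ.integral_fst'[symmetric]) auto
    also have "\<dots> = (\<integral>x. d x \<omega> \<partial>Q)\<^sup>2" by (simp add: power2_eq_square)
    also have "(\<integral>x. d x \<omega> \<partial>Q) = vacant_length T L \<omega> - L * m"
      unfolding d_def using int by (simp add: len[OF \<omega>] measQ)
    finally show ?thesis by simp
  qed
  have intM: "integrable ((Q \<Otimes>\<^sub>M Q) \<Otimes>\<^sub>M M) (\<lambda>p. d (fst (fst p)) (snd p) * d (snd (fst p)) (snd p))"
    using dd unfolding d_def by (intro Q2M'.integrable_const_bound[where B = 1] AE_I2) auto
  have "integrable M (\<lambda>\<omega>. \<integral>p. d (fst p) \<omega> * d (snd p) \<omega> \<partial>(Q \<Otimes>\<^sub>M Q))"
    using Q2M.integrable_snd[of "\<lambda>p \<omega>. d (fst p) \<omega> * d (snd p) \<omega>"] intM by (simp add: case_prod_unfold)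
  then show "integrable M (\<lambda>\<omega>. (vacant_length T L \<omega> - L * m)\<^sup>2)"
    by (subst Bochner_Integration.integrable_cong[OF refl sq]) auto
  define k where "k p r = indicator T r * r * indicator {\<bar>fst p - snd p\<bar>..} r" for p :: "real \<times> real" and r :: real
  have k: "\<bar>k p r\<bar> \<le> \<bar>K\<bar>" if "0 < r" for p r
    using T that by (auto simp: k_def indicator_def)
  have intr: "integrable ((Q \<Otimes>\<^sub>M Q) \<Otimes>\<^sub>M \<mu>) (\<lambda>q. k (fst q) (snd q))"
  proof (intro Q2r'.integrable_const_bound[where B = "\<bar>K\<bar>"] AE_I2)
    have [measurable]: "snd \<in> borel_measurable ((Q \<Otimes>\<^sub>M Q) \<Otimes>\<^sub>M \<mu>)"
      using measurable_compose[OF measurable_snd measurable_ident_radius] by simp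
    show "(\<lambda>q. k (fst q) (snd q)) \<in> borel_measurable ((Q \<Otimes>\<^sub>M Q) \<Otimes>\<^sub>M \<mu>)"
      unfolding k_def indicator_def atLeast_iff by measurable
  qed (auto simp: space_pair_measure space_radius intro!: k)
  have near: "(\<integral>p. k p r \<partial>(Q \<Otimes>\<^sub>M Q)) \<le> 2 * L * (indicator T r * r\<^sup>2)" if r: "0 < r" for r
  proof -
    define A where "A = {p \<in> space (Q \<Otimes>\<^sub>M Q). \<bar>fst p - snd p\<bar> \<le> r}"
    have A[measurable]: "A \<in> sets (Q \<Otimes>\<^sub>M Q)" unfolding A_def by measurable
    have "emeasure (Q \<Otimes>\<^sub>M Q) A = (\<integral>\<^sup>+x. emeasure Q (Pair x -` A) \<partial>Q)"
      by (rule Q.emeasure_pair_measure_alt[OF A])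
    also have "\<dots> \<le> (\<integral>\<^sup>+x. ennreal (2 * r) \<partial>Q)"
    proof (intro nn_integral_mono)
      fix x assume "x \<in> space Q"
      have "emeasure Q (Pair x -` A) \<le> emeasure lborel {x - r..x + r}"
        using sets_Pair1[OF A, of x]
        by (auto simp: Q_def emeasure_restrict_space A_def space_pair_measure space_restrict_space
            sets_restrict_space_iff intro!: emeasure_mono)
      then show "emeasure Q (Pair x -` A) \<le> ennreal (2 * r)" using r by simp
    qed
    also have "\<dots> = ennreal (2 * r * L)" using r L by (simp add: emQ ennreal_mult')
    finally have "measure (Q \<Otimes>\<^sub>M Q) A \<le> 2 * r * L"
      using r L by (simp add: Sigma_Algebra.measure_def enn2real_leI)
    moreover have "(\<integral>p. k p r \<partial>(Q \<Otimes>\<^sub>M Q)) = (\<integral>p. (indicator T r * r) * indicator A p \<partial>(Q \<Otimes>\<^sub>M Q))"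
      by (intro Bochner_Integration.integral_cong) (auto simp: k_def A_def indicator_def)
    moreover have "\<dots> = (indicator T r * r) * measure (Q \<Otimes>\<^sub>M Q) A"
      using sets.sets_into_space[OF A] by (simp add: Int_absorb2)
    ultimately show ?thesis
      using r mult_left_mono[of "measure (Q \<Otimes>\<^sub>M Q) A" "2 * r * L" "indicator T r * r"]
      by (simp add: power2_eq_square ac_simps)
  qed
  have "expectation (\<lambda>\<omega>. (vacant_length T L \<omega> - L * m)\<^sup>2) =
      expectation (\<lambda>\<omega>. \<integral>p. d (fst p) \<omega> * d (snd p) \<omega> \<partial>(Q \<Otimes>\<^sub>M Q))"
    by (intro Bochner_Integration.integral_cong sq) auto
  also have "\<dots> = (\<integral>p. expectation (\<lambda>\<omega>. d (fst p) \<omega> * d (snd p) \<omega>) \<partial>(Q \<Otimes>\<^sub>M Q))"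
    using intM by (intro Q2M.Fubini_integral) (simp add: case_prod_unfold)
  also have "\<dots> \<le> (\<integral>p. lam * (\<integral>r. k p r \<partial>\<mu>) \<partial>(Q \<Otimes>\<^sub>M Q))"
  proof (intro integral_mono)
    show "integrable (Q \<Otimes>\<^sub>M Q) (\<lambda>p. expectation (\<lambda>\<omega>. d (fst p) \<omega> * d (snd p) \<omega>))"
      using Q2M.integrable_fst[of "\<lambda>p \<omega>. d (fst p) \<omega> * d (snd p) \<omega>"] intM by (simp add: case_prod_unfold)
    show "integrable (Q \<Otimes>\<^sub>M Q) (\<lambda>p. lam * (\<integral>r. k p r \<partial>\<mu>))"
      using Q2r.integrable_fst[of k] intr by (simp add: case_prod_unfold)
    show "expectation (\<lambda>\<omega>. d (fst p) \<omega> * d (snd p) \<omega>) \<le> lam * (\<integral>r. k p r \<partial>\<mu>)"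
      if "p \<in> space (Q \<Otimes>\<^sub>M Q)" for p
      using that vacancy_covariance[of T K "fst p" "snd p"] T
      by (auto simp: space_pair_measure spQ d_def k_def m_def)
  qed
  also have "\<dots> = lam * (\<integral>r. (\<integral>p. k p r \<partial>(Q \<Otimes>\<^sub>M Q)) \<partial>\<mu>)"
    using Q2r.Fubini_integral[of k] intr by (simp add: case_prod_unfold)
  also have "\<dots> \<le> lam * (\<integral>r. 2 * L * (indicator T r * r\<^sup>2) \<partial>\<mu>)"
  proof (intro mult_left_mono integral_mono)
    show "integrable \<mu> (\<lambda>r. \<integral>p. k p r \<partial>(Q \<Otimes>\<^sub>M Q))"
      using Q2r.integrable_snd[of k] intr by (simp add: case_prod_unfold)
    show "integrable \<mu> (\<lambda>r. 2 * L * (indicator T r * r\<^sup>2))"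
      using T by (intro integrable_mult_right radius.integrable_const_bound[where B = "K\<^sup>2"] AE_I2)
        (auto simp: space_radius indicator_def intro!: power_mono)
  qed (use near lam_pos in \<open>auto simp: space_radius\<close>)
  finally show "expectation (\<lambda>\<omega>. (vacant_length T L \<omega> - L * m)\<^sup>2) \<le>
      2 * lam * L * (\<integral>r. indicator T r * r\<^sup>2 \<partial>\<mu>)"
    by simp
qed

section \<open>Almost sure limit of the vacant fraction\<close>

lemma fmeasurable_vacant:
  assumes "T \<in> sets borel" "\<omega> \<in> space M"
  shows "{x \<in> {0..L}. \<omega> \<in> void (covering T 0 x)} \<in> fmeasurable lborel"
proof -
  have "(\<lambda>x. (x, \<omega>)) -` {p \<in> space (borel \<Otimes>\<^sub>M M). snd p \<in> void (covering T 0 (fst p))} \<in> sets borel"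
    by (rule sets_Pair2[OF sets_vacancy[OF assms(1)]])
  also have "(\<lambda>x. (x, \<omega>)) -` {p \<in> space (borel \<Otimes>\<^sub>M M). snd p \<in> void (covering T 0 (fst p))} =
      {x. \<omega> \<in> void (covering T 0 x)}"
    using assms by (auto simp: space_pair_measure)
  finally have "{0..L} \<inter> {x. \<omega> \<in> void (covering T 0 x)} \<in> sets lborel" by simp
  also have "{0..L} \<inter> {x. \<omega> \<in> void (covering T 0 x)} = {x \<in> {0..L}. \<omega> \<in> void (covering T 0 x)}" by auto
  finally show ?thesis by (rule fmeasurableI2[of "{0..L}", rotated 2]) (auto simp: fmeasurable_def emeasure_lborel_Icc_eq)
qed

lemma vacant_length_mono:
  assumes "T \<in> sets borel" "\<omega> \<in> space M" "0 \<le> x" "x \<le> y"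
  shows "vacant_length T x \<omega> \<le> vacant_length T y \<omega>"
  using assms unfolding vacant_length_def
  by (intro measure_mono_fmeasurable fmeasurable_vacant
      fmeasurable_vacant[THEN fmeasurableD]) auto

text \<open>Chebyshev and Borel-Cantelli keep the truncated fraction close to \<open>m k\<close>, a
  second use of Borel-Cantelli makes truncated and full vacant lengths eventually equal, and
  \<open>m k\<close> converges by dominated convergence.\<close>

lemma vacant_fraction_geometric:
  fixes a :: real
  assumes [measurable]: "T \<in> sets borel" and int: "integrable \<mu> (\<lambda>r. indicator T r * r)" and a: "a > 1"
  shows "AE \<omega> in M. (\<lambda>k. vacant_length T (a ^ k) \<omega> / a ^ k) \<longlonglongrightarrow> exp (- lam * mean_radius T)"
proof -
  define R where "R k = T \<inter> {..a ^ k}" for k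
  have R[measurable]: "R k \<in> sets borel" for k unfolding R_def by measurable
  define m where "m k = exp (- lam * mean_radius (R k))" for k
  have apos: "a ^ k > 0" for k using a by simp
  have m_lim: "m \<longlonglongrightarrow> exp (- lam * mean_radius T)"
  proof -
    have "(\<lambda>k. mean_radius (R k)) \<longlonglongrightarrow> mean_radius T"
      unfolding mean_radius_def
    proof (rule integral_dominated_convergence[where w = "\<lambda>r. indicator T r * r"])
      show "AE r in \<mu>. (\<lambda>k. indicator (R k) r * r) \<longlonglongrightarrow> indicator T r * r"
      proof (intro AE_I2 tendsto_eventually)
        fix r
        obtain j where "r < a ^ j" using real_arch_pow[OF a] by blast
        then have "r < a ^ k" if "k \<ge> j" for k
          using power_increasing[OF that, of a] a by linarith
        then have "\<forall>\<^sub>F k in sequentially. r < a ^ k" by (rule eventually_sequentiallyI)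
        then show "\<forall>\<^sub>F k in sequentially. indicator (R k) r * r = indicator T r * r"
          by eventually_elim (auto simp: R_def indicator_def)
      qed
    qed (use int in \<open>auto simp: R_def indicator_def space_radius\<close>)
    then show ?thesis unfolding m_def by (intro tendsto_intros)
  qed
  define N where "N k = {p \<in> space S. snd p \<in> T} \<inter>
    {p \<in> space S. 0 \<le> fst p \<and> fst p < a ^ k \<and> a ^ k < snd p}" for k
  have N[measurable]: "N k \<in> sets S" for k
    unfolding N_def by (intro sets.Int; measurable)
  have long: "AE \<omega> in M. \<forall>\<^sub>F k in sequentially. \<omega> \<in> space M - (space M - void (N k))"
  proof (intro borel_cantelli_AE1)
    define g where "g k r = a ^ k * indicator (T \<inter> {a ^ k<..}) r" for k and r :: real
    have g_int: "integrable \<mu> (g k)" for k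
      unfolding g_def using apos[of k]
      by (intro radius.integrable_const_bound[where B = "a ^ k"] AE_I2) (auto simp: indicator_def)
    have g_nonneg: "g k r \<ge> 0" for k r using apos[of k] by (simp add: g_def)
    have "summable (\<lambda>k. \<integral>r. g k r \<partial>\<mu>)"
    proof (rule summable_integral_dominated[OF g_int g_nonneg])
      show "integrable \<mu> (\<lambda>r. a / (a - 1) * (indicator T r * r))" using int by simp
      fix n r assume "r \<in> space \<mu>"
      then have r: "r > 0" by (simp add: space_radius)
      show "(\<Sum>k<n. g k r) \<le> a / (a - 1) * (indicator T r * r)"
      proof (cases "r \<in> T")
        case True
        then have "(\<Sum>k<n. g k r) = (\<Sum>k<n. if a ^ k < r then a ^ k else 0)"
          by (intro sum.cong) (auto simp: g_def indicator_def)
        then show ?thesis using truncated_geometric_sum[OF a r, of n] True by simp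
      qed (simp add: g_def)
    qed
    then have sm: "summable (\<lambda>k. lam * (\<integral>r. g k r \<partial>\<mu>))" by (rule summable_mult)
    show "summable (\<lambda>k. prob (space M - void (N k)))"
    proof (rule summable_comparison_test'[OF sm])
      fix k
      have "emeasure lborel {u. (u, r) \<in> N k} = ennreal (g k r)" if "r > 0" for r
      proof -
        have "{u. (u, r) \<in> N k} = (if r \<in> T \<and> a ^ k < r then {0..<a ^ k} else {})"
          using that by (auto simp: N_def space_S)
        then show ?thesis using apos[of k] by (auto simp: g_def indicator_def)
      qed
      then have "prob (void (N k)) = exp (- lam * (\<integral>r. g k r \<partial>\<mu>))"
        by (intro prob_void_integral N g_int g_nonneg)
      then have "prob (space M - void (N k)) \<le> lam * (\<integral>r. g k r \<partial>\<mu>)"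
        using exp_ge_add_one_self[of "- lam * (\<integral>r. g k r \<partial>\<mu>)"] by (simp add: prob_compl)
      then show "norm (prob (space M - void (N k))) \<le> lam * (\<integral>r. g k r \<partial>\<mu>)" by simp
    qed
  qed (auto simp: emeasure_eq_measure)
  have dev: "AE \<omega> in M. \<forall>\<^sub>F k in sequentially.
      \<omega> \<in> space M - {\<omega> \<in> space M. \<bar>vacant_length (R k) (a ^ k) \<omega> - a ^ k * m k\<bar> \<ge> a ^ k * e}"
    if e: "e > 0" for e
  proof (intro borel_cantelli_AE1)
    have RK: "R k \<subseteq> {..a ^ k}" for k by (auto simp: R_def)
    note mom = vacant_length_second_moment[OF R RK apos[THEN less_imp_le], folded m_def]
    note mom(1)[measurable]
    show "{\<omega> \<in> space M. \<bar>vacant_length (R k) (a ^ k) \<omega> - a ^ k * m k\<bar> \<ge> a ^ k * e} \<in> events" for k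
      by measurable
    \<comment> \<open>Up to the factor \<open>2 * lam / e\<^sup>2\<close>, the integral of
      \<open>g k\<close> is the Chebyshev bound at scale \<open>a ^ k\<close>.\<close>
    define g where "g k r = indicator (R k) r * r\<^sup>2 / a ^ k" for k r
    have g_int: "integrable \<mu> (g k)" for k
      unfolding g_def
      by (intro integrable_divide_zero radius.integrable_const_bound[where B = "(a ^ k)\<^sup>2"] AE_I2)
         (auto simp: R_def indicator_def space_radius intro!: power_mono)
    have g_nonneg: "g k r \<ge> 0" for k r using apos[of k] by (simp add: g_def)
    have "summable (\<lambda>k. \<integral>r. g k r \<partial>\<mu>)"
    proof (rule summable_integral_dominated[OF g_int g_nonneg])
      show "integrable \<mu> (\<lambda>r. a / (a - 1) * (indicator T r * r))" using int by simp
      fix n r assume "r \<in> space \<mu>"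
      then have r: "r > 0" by (simp add: space_radius)
      show "(\<Sum>k<n. g k r) \<le> a / (a - 1) * (indicator T r * r)"
      proof (cases "r \<in> T")
        case True
        then have "(\<Sum>k<n. g k r) = (\<Sum>k<n. if r \<le> a ^ k then r / a ^ k else 0) * r"
          unfolding sum_distrib_right
          by (intro sum.cong) (auto simp: g_def R_def indicator_def power2_eq_square)
        then show ?thesis
          using mult_right_mono[OF truncated_geometric_sum_inverse[OF a r, of n], of r] r True by simp
      qed (simp add: g_def R_def)
    qed
    then have sm: "summable (\<lambda>k. 2 * lam / e\<^sup>2 * (\<integral>r. g k r \<partial>\<mu>))" by (rule summable_mult)
    show "summable (\<lambda>k. prob {\<omega> \<in> space M. \<bar>vacant_length (R k) (a ^ k) \<omega> - a ^ k * m k\<bar> \<ge> a ^ k * e})"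
    proof (rule summable_comparison_test'[OF sm])
      fix k
      have "prob {\<omega> \<in> space M. \<bar>vacant_length (R k) (a ^ k) \<omega> - a ^ k * m k\<bar> \<ge> a ^ k * e} \<le>
          expectation (\<lambda>\<omega>. (vacant_length (R k) (a ^ k) \<omega> - a ^ k * m k)\<^sup>2) / (a ^ k * e)\<^sup>2"
        using apos[of k] e by (intro second_moment_method mom(2)) auto
      also have "\<dots> \<le> 2 * lam * a ^ k * (\<integral>r. indicator (R k) r * r\<^sup>2 \<partial>\<mu>) / (a ^ k * e)\<^sup>2"
        by (intro divide_right_mono mom(3)) auto
      also have "\<dots> = 2 * lam / e\<^sup>2 * (\<integral>r. g k r \<partial>\<mu>)"
        using apos[of k] e by (simp add: g_def field_simps power2_eq_square)
      finally show "norm (prob {\<omega> \<in> space M. \<bar>vacant_length (R k) (a ^ k) \<omega> - a ^ k * m k\<bar> \<ge> a ^ k * e})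
          \<le> 2 * lam / e\<^sup>2 * (\<integral>r. g k r \<partial>\<mu>)" by simp
    qed
  qed (simp add: emeasure_eq_measure)
  have "AE \<omega> in M. \<forall>j::nat. \<forall>\<^sub>F k in sequentially.
      \<omega> \<in> space M - {\<omega> \<in> space M. \<bar>vacant_length (R k) (a ^ k) \<omega> - a ^ k * m k\<bar> \<ge> a ^ k * (1 / real (Suc j))}"
    unfolding AE_all_countable by (intro allI dev) simp
  with long AE_space show ?thesis
  proof eventually_elim
    case (elim \<omega>)
    \<comment> \<open>A point of \<open>{0..a ^ k}\<close> can only be covered by intervals starting
      before \<open>a ^ k\<close>, and none of these has a discarded radius when \<open>N k\<close>
      is empty.\<close>
    have same: "\<forall>\<^sub>F k in sequentially. vacant_length (R k) (a ^ k) \<omega> = vacant_length T (a ^ k) \<omega>"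
      using elim(1)
    proof eventually_elim
      case (elim k)
      then have no: "P \<omega> \<inter> N k = {}" by (auto simp: void_def)
      have "\<omega> \<in> void (covering (R k) 0 x) \<longleftrightarrow> \<omega> \<in> void (covering T 0 x)" if "x \<le> a ^ k" for x
      proof -
        have "P \<omega> \<inter> covering (R k) 0 x = P \<omega> \<inter> covering T 0 x"
          using no that by (fastforce simp: covering_def R_def N_def)
        then show ?thesis by (simp add: void_def)
      qed
      then show ?case unfolding vacant_length_def by (intro arg_cong[where f = "measure lborel"]) auto
    qed
    have "(\<lambda>k. vacant_length T (a ^ k) \<omega> / a ^ k - m k) \<longlonglongrightarrow> 0"
    proof (rule LIMSEQ_I)
      fix e :: real assume "e > 0"
      then obtain j where j: "1 / real (Suc j) < e" using nat_approx_posE by blast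
      from elim(3)[rule_format, of j] same
      have "\<forall>\<^sub>F k in sequentially. norm (vacant_length T (a ^ k) \<omega> / a ^ k - m k - 0) < e"
      proof eventually_elim
        case (elim k)
        have "vacant_length T (a ^ k) \<omega> / a ^ k - m k = (vacant_length T (a ^ k) \<omega> - a ^ k * m k) / a ^ k"
          using a by (simp add: diff_divide_distrib)
        then have "\<bar>vacant_length T (a ^ k) \<omega> / a ^ k - m k\<bar> = \<bar>vacant_length T (a ^ k) \<omega> - a ^ k * m k\<bar> / a ^ k"
          using apos[of k] by simp
        also have "\<dots> < 1 / real (Suc j)"
          using elim apos[of k] by (simp add: divide_less_eq ac_simps not_le)
        finally show ?case using j by simp
      qed
      then show "\<exists>no. \<forall>n\<ge>no. norm (vacant_length T (a ^ n) \<omega> / a ^ n - m n - 0) < e"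
        by (simp add: eventually_sequentially)
    qed
    from tendsto_add[OF this m_lim] show ?case by simp
  qed
qed

lemma vacant_fraction:
  assumes "T \<in> sets borel" "integrable \<mu> (\<lambda>r. indicator T r * r)"
  shows "AE \<omega> in M. (\<lambda>n. vacant_length T (real n) \<omega> / real n) \<longlonglongrightarrow> exp (- lam * mean_radius T)"
proof -
  have "AE \<omega> in M. \<forall>j::nat. (\<lambda>k. vacant_length T ((1 + 1 / real (Suc j)) ^ k) \<omega> / (1 + 1 / real (Suc j)) ^ k)
      \<longlonglongrightarrow> exp (- lam * mean_radius T)"
    unfolding AE_all_countable by (intro allI vacant_fraction_geometric assms) simp
  with AE_space show ?thesis
  proof eventually_elim
    case (elim \<omega>)
    then show ?case
      by (intro tendsto_from_geometric_subsequences vacant_length_mono assms)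
         (auto simp: vacant_length_def)
  qed
qed

section \<open>From the vacant length to the covered fraction\<close>

lemma occupied_length:
  assumes \<omega>: "\<omega> \<in> space M"
  shows "measure lborel ({0..real n} \<inter> occupied_set (P \<omega>)) = real n - vacant_length UNIV (real n) \<omega>"
proof -
  let ?A = "{0..real n} \<inter> occupied_set (P \<omega>)"
  let ?B = "{x \<in> {0..real n}. \<omega> \<in> void (covering UNIV 0 x)}"
  \<comment> \<open>All endpoints of intervals: the closed occupied set and the set left vacant by
    open intervals overlap only here.\<close>
  define C where "C = fst ` P \<omega> \<union> (\<lambda>p. fst p + snd p) ` P \<omega>"
  have "countable C" unfolding C_def using countable_P[OF \<omega>] by auto
  then have "C \<in> null_sets lborel" by (rule countable_imp_null_set_lborel)
  have cov: "x \<in> occupied_set (P \<omega>)" if x: "\<omega> \<notin> void (covering UNIV 0 x)" for x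
  proof -
    obtain u r where "(u, r) \<in> P \<omega>" "(u, r) \<in> covering UNIV 0 x" using x \<omega> by (auto simp: void_def)
    then show ?thesis unfolding occupied_set_def by (intro UN_I[of "(u, r)"]) (auto simp: covering_def)
  qed
  have end_point: "x \<in> C" if occ: "x \<in> occupied_set (P \<omega>)" and void: "\<omega> \<in> void (covering UNIV 0 x)" for x
  proof (rule ccontr)
    assume x: "x \<notin> C"
    obtain u r where p: "(u, r) \<in> P \<omega>" "0 \<le> u" "u \<le> x" "x \<le> u + r"
      using occ by (auto simp: occupied_set_def)
    have "u \<in> C" "u + r \<in> C" unfolding C_def using p(1) by force+
    then have "u \<noteq> x" "u + r \<noteq> x" using x by auto
    then have "(u, r) \<in> covering UNIV 0 x" using p P_subset[OF \<omega>] by (auto simp: covering_def)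
    then show False using void p(1) by (auto simp: void_def)
  qed
  have "occupied_set (P \<omega>) = (\<Union>p\<in>{p \<in> P \<omega>. 0 \<le> fst p}. {fst p..fst p + snd p})"
    by (auto simp: occupied_set_def)
  also have "\<dots> \<in> sets borel"
    by (intro sets.countable_UN'' countable_subset[OF _ countable_P[OF \<omega>]]) auto
  finally have "?A \<in> sets lborel" by simp
  then have A: "?A \<in> fmeasurable lborel" by (rule fmeasurableI2[of "{0..real n}", rotated 2]) (auto simp: fmeasurable_def emeasure_lborel_Icc_eq)
  have B: "?B \<in> fmeasurable lborel" by (rule fmeasurable_vacant[OF _ \<omega>]) simp
  have "measure lborel (?A \<union> ?B) = measure lborel ?A + measure lborel ?B"
  proof (rule measure_Un_AE[OF _ A B])
    show "AE x in lborel. x \<notin> ?A \<or> x \<notin> ?B"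
      using AE_not_in[OF \<open>C \<in> null_sets lborel\<close>] by eventually_elim (use end_point in auto)
  qed
  moreover have "?A \<union> ?B = {0..real n}" using cov by auto
  ultimately show ?thesis by (simp add: vacant_length_def)
qed

lemma has_covered_fraction_iff:
  assumes "\<omega> \<in> space M"
  shows "has_covered_fraction (occupied_set (P \<omega>)) v \<longleftrightarrow>
    (\<lambda>n. vacant_length UNIV (real n) \<omega> / real n) \<longlonglongrightarrow> 1 - v"
proof -
  have "{- real n..real n} \<inter> {0..} = {0..real n}" for n by auto
  then have "has_covered_fraction (occupied_set (P \<omega>)) v \<longleftrightarrow>
      (\<lambda>n. (real n - vacant_length UNIV (real n) \<omega>) / real n) \<longlonglongrightarrow> v"
    by (simp add: has_covered_fraction_def occupied_length[OF assms])
  \<comment> \<open>At \<open>n = 0\<close>, division by zero gives 0 on one side and 1 on the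
    other, so the sequences are compared from 1 on.\<close>
  also have "\<dots> \<longleftrightarrow> (\<lambda>n. 1 - vacant_length UNIV (real n) \<omega> / real n) \<longlonglongrightarrow> v"
    by (intro tendsto_cong eventually_sequentiallyI[of 1]) (simp add: field_simps)
  also have "\<dots> \<longleftrightarrow> (\<lambda>n. vacant_length UNIV (real n) \<omega> / real n) \<longlonglongrightarrow> 1 - v"
    using tendsto_diff[OF tendsto_const[of 1], of "\<lambda>n. 1 - vacant_length UNIV (real n) \<omega> / real n" v sequentially]
      tendsto_diff[OF tendsto_const[of 1], of "\<lambda>n. vacant_length UNIV (real n) \<omega> / real n" "1 - v" sequentially]
    by auto
  finally show ?thesis .
qed

lemma covered_fraction_finite_mean:
  assumes "integrable \<mu> (\<lambda>r. r)"
  shows "AE \<omega> in M. has_covered_fraction (occupied_set (P \<omega>)) (1 - exp (- lam * (\<integral>r. r \<partial>\<mu>)))"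
proof -
  have "AE \<omega> in M. (\<lambda>n. vacant_length UNIV (real n) \<omega> / real n) \<longlonglongrightarrow> exp (- lam * mean_radius UNIV)"
    using assms by (intro vacant_fraction) auto
  with AE_space show ?thesis
    by eventually_elim (simp add: has_covered_fraction_iff mean_radius_def)
qed

text \<open>Removing long radii can only increase the vacant length, so the limit for each
  truncation bounds the full vacant fraction from above, and these limits tend to 0 as the truncated
  means grow without bound.\<close>

lemma covered_fraction_infinite_mean:
  assumes "(\<integral>\<^sup>+r. ennreal r \<partial>\<mu>) = \<infinity>"
  shows "AE \<omega> in M. has_covered_fraction (occupied_set (P \<omega>)) 1"
proof -
  have int: "integrable \<mu> (\<lambda>r. indicator {..real K} r * r)" for K :: nat
    by (intro radius.integrable_const_bound[where B = "real K"] AE_I2) (auto simp: space_radius indicator_def)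
  have unbounded: "\<exists>K::nat. mean_radius {..real K} > B" for B
  proof (rule ccontr)
    assume "\<nexists>K::nat. mean_radius {..real K} > B"
    then have B: "mean_radius {..real K} \<le> B" for K by (simp add: not_less)
    have "(\<integral>\<^sup>+r. ennreal r \<partial>\<mu>) = (\<integral>\<^sup>+r. (SUP K::nat. ennreal (indicator {..real K} r * r)) \<partial>\<mu>)"
    proof (intro nn_integral_cong antisym SUP_least)
      fix r assume "r \<in> space \<mu>"
      then have r: "r > 0" by (simp add: space_radius)
      have "ennreal r = ennreal (indicator {..real (nat \<lceil>r\<rceil>)} r * r)" by (simp add: indicator_def; linarith)
      also have "\<dots> \<le> (SUP K::nat. ennreal (indicator {..real K} r * r))" by (rule SUP_upper) simp
      finally show "ennreal r \<le> (SUP K::nat. ennreal (indicator {..real K} r * r))" .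
      show "ennreal (indicator {..real K} r * r) \<le> ennreal r" for K :: nat
        using r by (auto simp: indicator_def)
    qed
    also have "\<dots> = (SUP K::nat. \<integral>\<^sup>+r. ennreal (indicator {..real K} r * r) \<partial>\<mu>)"
    proof (rule nn_integral_monotone_convergence_SUP_AE)
      show "AE r in \<mu>. ennreal (indicator {..real i} r * r) \<le> ennreal (indicator {..real (Suc i)} r * r)" for i :: nat
        by (intro AE_I2) (auto simp: space_radius indicator_def)
    qed measurable
    also have "\<dots> \<le> ennreal B"
    proof (intro SUP_least)
      fix K :: nat
      have "(\<integral>\<^sup>+r. ennreal (indicator {..real K} r * r) \<partial>\<mu>) = ennreal (mean_radius {..real K})"
        unfolding mean_radius_def by (intro nn_integral_eq_integral int AE_I2) (auto simp: space_radius)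
      then show "(\<integral>\<^sup>+r. ennreal (indicator {..real K} r * r) \<partial>\<mu>) \<le> ennreal B"
        using B[of K] by (simp add: ennreal_leI)
    qed
    finally show False using assms by (simp add: top_unique)
  qed
  have "AE \<omega> in M. \<forall>K::nat. (\<lambda>n. vacant_length {..real K} (real n) \<omega> / real n)
      \<longlonglongrightarrow> exp (- lam * mean_radius {..real K})"
    unfolding AE_all_countable by (intro allI vacant_fraction int) simp
  with AE_space show ?thesis
  proof eventually_elim
    case (elim \<omega>)
    have le: "vacant_length UNIV (real n) \<omega> \<le> vacant_length {..real K} (real n) \<omega>" for K n
      unfolding vacant_length_def using elim(1)
      by (intro measure_mono_fmeasurable fmeasurable_vacant
      fmeasurable_vacant[THEN fmeasurableD]) (auto simp: void_def covering_def)
    have "(\<lambda>n. vacant_length UNIV (real n) \<omega> / real n) \<longlonglongrightarrow> 0"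
    proof (rule order_tendstoI)
      fix c :: real assume "c < 0"
      moreover have "0 \<le> vacant_length UNIV (real n) \<omega> / real n" for n
        by (simp add: vacant_length_def)
      ultimately show "\<forall>\<^sub>F n in sequentially. c < vacant_length UNIV (real n) \<omega> / real n"
        by (intro always_eventually allI) (rule less_le_trans)
    next
      fix c :: real assume c: "0 < c"
      \<comment> \<open>The threshold solves \<open>exp (- lam * x) = c\<close> for
        \<open>x\<close>.\<close>
      obtain K :: nat where "mean_radius {..real K} > - ln c / lam" using unbounded by blast
      then have "exp (- lam * mean_radius {..real K}) < exp (ln c)"
        using lam_pos by (subst exp_less_cancel_iff) (simp add: field_simps)
      then have "exp (- lam * mean_radius {..real K}) < c" using c by simp
      from order_tendstoD(2)[OF elim(2)[rule_format, of K] this]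
      show "\<forall>\<^sub>F n in sequentially. vacant_length UNIV (real n) \<omega> / real n < c"
        by eventually_elim (metis divide_right_mono le le_less_trans of_nat_0_le_iff)
    qed
    then show ?case using elim(1) by (simp add: has_covered_fraction_iff)
  qed
qed

end

section \<open>The three regimes, expressed through the random variable rho\<close>

theorem theorem1p1:
  fixes lam :: real
    and \<mu> :: "real measure"
    and N :: "'b measure" and \<rho> :: "'b \<Rightarrow> real"
    and M :: "'w measure" and P :: "'w \<Rightarrow> (real \<times> real) set"
  assumes lam_pos: "lam > 0"
    and \<mu>_prob: "prob_space \<mu>"
    and \<mu>_sets: "sets \<mu> = sets (restrict_space borel {0<..})"
    and N_prob: "prob_space N"
    and \<rho>_rv: "\<rho> \<in> measurable N \<mu>"
    and \<rho>_distr: "distr N \<mu> \<rho> = \<mu>"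
    and M_prob: "prob_space M"
    and P_poisson: "poisson_point_process M (scale_measure (ennreal lam) lborel \<Otimes>\<^sub>M \<mu>) P"
  shows
    "((\<integral>\<^sup>+ w. ennreal (\<rho> w) \<partial>N) < \<infinity> \<longrightarrow>
        (AE \<omega> in M. \<not> has_unbounded_component (occupied_set (P \<omega>))) \<and>
        (AE \<omega> in M. has_covered_fraction (occupied_set (P \<omega>))
           (1 - exp (- lam * (\<integral> w. \<rho> w \<partial>N)))))
     \<and>
     ((\<integral>\<^sup>+ t\<in>{0<..}. ennreal (exp (- lam * (\<integral> w. min (\<rho> w) t \<partial>N))) \<partial>lborel) < \<infinity> \<longrightarrow>
        (AE \<omega> in M. has_unbounded_component (occupied_set (P \<omega>))))
     \<and>
     ((\<integral>\<^sup>+ w. ennreal (\<rho> w) \<partial>N) = \<infinity> \<and>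
      (\<integral>\<^sup>+ t\<in>{0<..}. ennreal (exp (- lam * (\<integral> w. min (\<rho> w) t \<partial>N))) \<partial>lborel) = \<infinity> \<longrightarrow>
        (AE \<omega> in M. \<not> has_unbounded_component (occupied_set (P \<omega>))) \<and>
        (\<integral>\<^sup>+ \<omega>. component_size (occupied_set (P \<omega>)) 1 \<partial>M) = \<infinity> \<and>
        (AE \<omega> in M. has_covered_fraction (occupied_set (P \<omega>)) 1))"
proof -
  interpret boolean_percolation M lam \<mu> P
    using M_prob lam_pos \<mu>_prob \<mu>_sets P_poisson
    by (intro boolean_percolation.intro boolean_percolation_axioms.intro)
  interpret N: prob_space N by (rule N_prob)
  have "(\<integral>\<^sup>+ r. ennreal r \<partial>distr N \<mu> \<rho>) = (\<integral>\<^sup>+ w. ennreal (\<rho> w) \<partial>N)"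
    by (rule nn_integral_distr[OF \<rho>_rv]) measurable
  then have mean: "(\<integral>\<^sup>+ w. ennreal (\<rho> w) \<partial>N) = (\<integral>\<^sup>+ r. ennreal r \<partial>\<mu>)"
    unfolding \<rho>_distr ..
  have "(\<integral> r. r \<partial>distr N \<mu> \<rho>) = (\<integral> w. \<rho> w \<partial>N)"
    by (rule integral_distr[OF \<rho>_rv]) measurable
  then have mean_real: "(\<integral> w. \<rho> w \<partial>N) = (\<integral> r. r \<partial>\<mu>)"
    unfolding \<rho>_distr ..
  have "(\<integral> r. min r t \<partial>distr N \<mu> \<rho>) = (\<integral> w. min (\<rho> w) t \<partial>N)" for t
    by (rule integral_distr[OF \<rho>_rv]) measurable
  then have "(\<integral> w. min (\<rho> w) t \<partial>N) = trunc_mean UNIV t" for t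
    unfolding \<rho>_distr by (simp add: trunc_mean_def)
  then have vacant_prob: "exp (- lam * (\<integral> w. min (\<rho> w) t \<partial>N)) = vacant_prob UNIV t" for t
    by (simp add: vacant_prob_def)
  have finite_mean: "integrable \<mu> (\<lambda>r. r)" if "(\<integral>\<^sup>+ r. ennreal r \<partial>\<mu>) < \<infinity>"
  proof (rule integrableI_nonneg)
    show "AE r in \<mu>. 0 \<le> r" by (intro AE_I2) (simp add: space_radius)
  qed (use that in auto)
  \<comment> \<open>With a finite mean, vacancy probabilities never fall below
    \<open>exp (- lam * mean_radius UNIV) > 0\<close>, so (i) also falls under the divergent
    case.\<close>
  have diverges: "(\<integral>\<^sup>+ t\<in>{0<..}. ennreal (vacant_prob UNIV t) \<partial>lborel) = \<infinity>"
    if "integrable \<mu> (\<lambda>r. r)"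
  proof -
    have "\<not> summable (\<lambda>n. vacant_prob UNIV (real (Suc n)))"
    proof
      assume "summable (\<lambda>n. vacant_prob UNIV (real (Suc n)))"
      then have "(\<lambda>n. vacant_prob UNIV (real (Suc n))) \<longlonglongrightarrow> 0" by (rule summable_LIMSEQ_zero)
      moreover have "exp (- lam * mean_radius UNIV) \<le> vacant_prob UNIV (real (Suc n))" for n
        using trunc_mean_le_mean_radius[of UNIV "real (Suc n)"] that lam_pos by (simp add: vacant_prob_def)
      ultimately have "exp (- lam * mean_radius UNIV) \<le> 0" by (intro LIMSEQ_le_const) auto
      then show False by simp
    qed
    then have "(\<Sum>n. ennreal (vacant_prob UNIV (real (Suc n)))) = \<infinity>"
      using summable_suminf_not_top[OF vacant_prob_pos[THEN less_imp_le], of "\<lambda>_. UNIV" "\<lambda>n. real (Suc n)"]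
      unfolding infinity_ennreal_def by (rule contrapos_np)
    moreover have "(\<Sum>n. ennreal (vacant_prob UNIV (real (Suc n)))) \<le> (\<integral>\<^sup>+ t\<in>{0<..}. ennreal (vacant_prob UNIV t) \<partial>lborel)"
      by (intro antimono_integral_bounds(1) vacant_prob_antimono) auto
    ultimately show ?thesis by (simp only: infinity_ennreal_def top_unique)
  qed
  show ?thesis
    unfolding mean mean_real vacant_prob
    using AE_not_has_unbounded_component[OF diverges[OF finite_mean]]
      covered_fraction_finite_mean[OF finite_mean] AE_has_unbounded_component
      AE_not_has_unbounded_component expected_component_size_infinite covered_fraction_infinite_mean
    by blast
qed

end
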